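(* Let $T$ be a forest of order $n$ (that is, $|V(T)|=n$) with maximum degree $\Delta(T)=\Delta$, and suppose that $$\Delta\ \geq\ \frac{n+2}{3}.$$ Then $$h(T)=\begin{cases}\Delta+2, & \text{if } T \text{ has two distinct non-adjacent vertices of degree } \Delta;\\ \Delta+1, & \text{otherwise.}\end{cases}$$ Moreover, there is a polynomial-time algorithm that, given such a forest $T$, produces an optimal harmonious coloring of $T$, i.e. a harmonious coloring of $T$ using exactly $h(T)$ colors.
   Context: All graphs are finite and simple. A harmonious coloring of a graph $G$ is a proper vertex coloring of $G$ such that every (unordered) pair of colors appears on at most one pair of adjacent vertices; that is, for any two distinct edges $xy$ and $x'y'$ of $G$, the sets of colors of their endpoints are different. The harmonious chromatic number $h(G)$ is the minimum number of colors needed for a harmonious coloring of $G$. $\Delta(G)$ denotes the maximum degree of $G$. A forest is an acyclic graph (not necessarily connected). Polynomial time means polynomial in $n$. *)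

theory Defs
  imports Complex_Main
begin

section \<open>Finite simple graphs and forests\<close>

definition simple_graph :: "'a set \<Rightarrow> 'a set set \<Rightarrow> bool" where
  "simple_graph V E \<longleftrightarrow> finite V \<and> (\<forall>e\<in>E. e \<subseteq> V \<and> card e = 2)"

text \<open>The list holds the vertices of the cycle in cyclic order, without repeating the first one.\<close>

definition is_cycle :: "'a set set \<Rightarrow> 'a list \<Rightarrow> bool" where
  "is_cycle E xs \<longleftrightarrow> 3 \<le> length xs \<and> distinct xs \<and>
     (\<forall>i<length xs. {xs ! i, xs ! (Suc i mod length xs)} \<in> E)"

definition forest :: "'a set \<Rightarrow> 'a set set \<Rightarrow> bool" where
  "forest V E \<longleftrightarrow> simple_graph V E \<and> (\<nexists>xs. is_cycle E xs)"

definition degree :: "'a set set \<Rightarrow> 'a \<Rightarrow> nat" where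
  "degree E v = card {e \<in> E. v \<in> e}"

text \<open>The graph without vertices gets maximum degree 0.\<close>

definition max_degree :: "'a set \<Rightarrow> 'a set set \<Rightarrow> nat" where
  "max_degree V E = Max (insert 0 (degree E ` V))"

section \<open>Harmonious colorings\<close>

definition harmonious_coloring :: "'a set \<Rightarrow> 'a set set \<Rightarrow> ('a \<Rightarrow> 'c) \<Rightarrow> bool" where
  "harmonious_coloring V E c \<longleftrightarrow>
     (\<forall>u\<in>V. \<forall>v\<in>V. {u, v} \<in> E \<longrightarrow> c u \<noteq> c v) \<and>
     (\<forall>e\<in>E. \<forall>e'\<in>E. e \<noteq> e' \<longrightarrow> c ` e \<noteq> c ` e')"

definition harmonious_number :: "'a set \<Rightarrow> 'a set set \<Rightarrow> nat" where
  "harmonious_number V E =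
     (LEAST k. \<exists>c :: 'a \<Rightarrow> nat. harmonious_coloring V E c \<and> card (c ` V) = k)"

section \<open>A machine model for polynomial time\<close>

text \<open>
  The model is a structured random access machine: a program works on finitely many named
  arrays of natural numbers of unbounded length, and a scalar variable is an array that is
  only accessed at index 0.
  Every assignment and every evaluation of a test costs one step.  The expressions occurring in a
  program are fixed with it, so that this differs from charging each arithmetic
  operation separately only by a constant factor depending on the program.
  The only arithmetic operations are addition and truncated subtraction.  Multiplication is
  left out on purpose, because at unit cost it would allow repeated squaring; as it
  is, the length in binary of the numbers grows by at most a constant in each step,
  and the model is polynomially equivalent to Turing machines.
\<close>

type_synonym state = "string \<Rightarrow> nat \<Rightarrow> nat"

datatype aexp =
    Num nat
  | Read string aexp
  | Plus aexp aexp
  | Minus aexp aexp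

datatype bexp =
    Less aexp aexp
  | Equal aexp aexp
  | Neg bexp
  | Conj bexp bexp

datatype com =
    Skip
  | Write string aexp aexp
  | Seq com com
  | Cond bexp com com
  | While bexp com

fun aval :: "aexp \<Rightarrow> state \<Rightarrow> nat" where
  "aval (Num k) s = k"
| "aval (Read x a) s = s x (aval a s)"
| "aval (Plus a b) s = aval a s + aval b s"
| "aval (Minus a b) s = aval a s - aval b s"

fun bval :: "bexp \<Rightarrow> state \<Rightarrow> bool" where
  "bval (Less a b) s \<longleftrightarrow> aval a s < aval b s"
| "bval (Equal a b) s \<longleftrightarrow> aval a s = aval b s"
| "bval (Neg p) s \<longleftrightarrow> \<not> bval p s"
| "bval (Conj p q) s \<longleftrightarrow> bval p s \<and> bval q s"

text \<open>\<open>exec p s t s'\<close>: started in \<open>s\<close>, the program \<open>p\<close> halts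
  in \<open>s'\<close> after exactly \<open>t\<close> steps.\<close>

inductive exec :: "com \<Rightarrow> state \<Rightarrow> nat \<Rightarrow> state \<Rightarrow> bool" where
  Skip: "exec Skip s 1 s"
| Write: "exec (Write x i a) s 1 (s(x := (s x)(aval i s := aval a s)))"
| Seq: "exec p s t s' \<Longrightarrow> exec q s' t' s'' \<Longrightarrow> exec (Seq p q) s (t + t') s''"
| CondTrue: "bval b s \<Longrightarrow> exec p s t s' \<Longrightarrow> exec (Cond b p q) s (t + 1) s'"
| CondFalse: "\<not> bval b s \<Longrightarrow> exec q s t s' \<Longrightarrow> exec (Cond b p q) s (t + 1) s'"
| WhileFalse: "\<not> bval b s \<Longrightarrow> exec (While b p) s 1 s"
| WhileTrue: "bval b s \<Longrightarrow> exec p s t s' \<Longrightarrow> exec (While b p) s' t' s'' \<Longrightarrow>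
    exec (While b p) s (t + t' + 1) s''"

inductive_cases exec_elims:
  "exec Skip s t s'" "exec (Write x i a) s t s'" "exec (Seq p q) s t s'"
  "exec (Cond b p q) s t s'" "exec (While b p) s t s'"

lemma exec_deterministic:
  "exec p s t s' \<Longrightarrow> exec p s u s'' \<Longrightarrow> u = t \<and> s'' = s'"
proof (induction arbitrary: u s'' rule: exec.induct)
  case (Skip s)
  then show ?case by (auto elim: exec_elims(1))
next
  case (Write x i a s)
  then show ?case by (auto elim: exec_elims(2))
next
  case (Seq p s t s' q t' s2)
  from Seq.prems obtain v r v' where
    "exec p s v r" "exec q r v' s''" "u = v + v'"
    by (rule exec_elims(3)) blast
  with Seq.IH show ?case by blast
next
  case (CondTrue b s p t s' q)
  from CondTrue.prems CondTrue.hyps(1) obtain v where "exec p s v s''" "u = v + 1"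
    by (auto elim: exec_elims(4))
  with CondTrue.IH show ?case by blast
next
  case (CondFalse b s q t s' p)
  from CondFalse.prems CondFalse.hyps(1) obtain v where "exec q s v s''" "u = v + 1"
    by (auto elim: exec_elims(4))
  with CondFalse.IH show ?case by blast
next
  case (WhileFalse b s p)
  from WhileFalse.prems WhileFalse.hyps(1) show ?case
    by (auto elim: exec_elims(5))
next
  case (WhileTrue b s p t s' t' s2)
  from WhileTrue.prems WhileTrue.hyps(1) obtain v r v' where
    "exec p s v r" "exec (While b p) r v' s''" "u = v + v' + 1"
    by (cases rule: exec_elims(5)) auto
  with WhileTrue.IH show ?case by blast
qed

text \<open>Initial memory for a graph with vertices \<open>0, \<dots>, n - 1\<close>: \<open>n\<close> and the
  adjacency matrix, row by row.\<close>

definition graph_input :: "nat \<Rightarrow> nat set set \<Rightarrow> state" where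
  "graph_input n E = (\<lambda>_ _. 0)
     (''n'' := (\<lambda>_. 0)(0 := n),
      ''adj'' := (\<lambda>k. if k < n * n \<and> {k div n, k mod n} \<in> E then 1 else 0))"

end

theory Submission
  imports Defs
begin

text \<open>
  Let \<open>v\<close> be a vertex of maximum degree \<open>\<Delta>\<close>.  In a harmonious coloring the closed neighborhood
  of \<open>v\<close> gets \<open>\<Delta> + 1\<close> different colors, and two non-adjacent vertices of degree \<open>\<Delta>\<close> cannot
  both see all of \<open>\<Delta> + 1\<close> colors; this gives the lower bounds.

  For the upper bounds let \<open>k\<close> be \<open>\<Delta>\<close>, or \<open>\<Delta> + 1\<close> if there are two such vertices.  Color
  \<open>v\<close> with \<open>0\<close>, its neighbors with different colors from \<open>{1..k}\<close>, and delete \<open>v\<close>.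
  What remains is a forest with at most \<open>2 k - 3\<close> edges and all degrees below \<open>k\<close>, in which the
  precolored vertices lie in different components, and which has to be colored with
  \<open>{1..k}\<close>.  The load of a color is the number of edges touching its class, including edges
  whose other end is still uncolored.  No load may exceed \<open>k - 1\<close>, the number of other colors.  The
  bound \<open>2 k - 3\<close> is the number of color pairs that meet two given colors, so that
  two colors which are not yet joined can never both be too demanding.

  A greedy procedure therefore works: color one vertex at a time, always keeping at most one
  colored neighbor, with any color that keeps the loads below \<open>k\<close> and creates no
  repeated pair.  Suppose that no color fits a vertex \<open>w\<close>.  Then each color still available to
  \<open>w\<close> has load at least \<open>k - degree w\<close>, and counting the touched edges contradicts the bound
  on the number of edges, except possibly if the degree of \<open>w\<close> is \<open>k - 2\<close> or \<open>k - 1\<close>.  In these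
  cases one uses that vertices of degree at least two are colored before the others, which
  keeps the colored part open-ended: every colored vertex with an edge is joined inside the
  colored part to an edge leaving it, and there are never more colored vertices with an
  edge than edges touched (\<open>fit_linked\<close>, \<open>fit_unlinked\<close>, \<open>growing_insert\<close>).

  Since any fitting color will do, the procedure is a short loop program.  All its loops are
  bounded by \<open>n\<close>, which gives termination in polynomial time by syntax alone
  (\<open>poly_time_For\<close>), and partial correctness is shown separately with weakest liberal
  preconditions, where the invariants are exactly those of the combinatorial argument.
\<close>

section \<open>Forests\<close>

definition conn :: "'a set set \<Rightarrow> ('a \<times> 'a) set" where
  "conn F = {(x, y). {x, y} \<in> F}\<^sup>*"

definition inner :: "'a set set \<Rightarrow> 'a set \<Rightarrow> 'a set set" where
  "inner E C = {e \<in> E. e \<subseteq> C}"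

text \<open>The colored vertices will be convex: they meet each component of the forest in a connected
  set.  This is the form in which acyclicity enters the coloring procedure, see \<open>one_link\<close>.\<close>

definition convex :: "'a set set \<Rightarrow> 'a set \<Rightarrow> bool" where
  "convex E C \<longleftrightarrow> (\<forall>x\<in>C. \<forall>y\<in>C. (x, y) \<in> conn E \<longrightarrow> (x, y) \<in> conn (inner E C))"

lemma conn_mono: "F \<subseteq> G \<Longrightarrow> conn F \<subseteq> conn G"
  unfolding conn_def by (rule rtrancl_mono) auto

lemma inner_mono: "C \<subseteq> D \<Longrightarrow> inner E C \<subseteq> inner E D"
  unfolding inner_def by auto

lemma conn_refl [simp]: "(x, x) \<in> conn F"
  by (simp add: conn_def)

lemma conn_edge: "{x, y} \<in> F \<Longrightarrow> (x, y) \<in> conn F"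
  unfolding conn_def by (rule r_into_rtrancl) simp

lemma conn_trans: "(x, y) \<in> conn F \<Longrightarrow> (y, z) \<in> conn F \<Longrightarrow> (x, z) \<in> conn F"
  unfolding conn_def by (rule rtrancl_trans)

lemma conn_sym: "(x, y) \<in> conn F \<Longrightarrow> (y, x) \<in> conn F"
proof -
  have "sym {(x, y). {x, y} \<in> F}" by (auto simp: sym_def insert_commute)
  then show "(x, y) \<in> conn F \<Longrightarrow> (y, x) \<in> conn F"
    unfolding conn_def using sym_rtrancl by (meson symD)
qed

lemma conn_closed:
  assumes "(x, y) \<in> conn F" "x \<in> X" "\<And>a b. a \<in> X \<Longrightarrow> {a, b} \<in> F \<Longrightarrow> b \<in> X"
  shows "y \<in> X"
  using assms(1) unfolding conn_def
  by (induction rule: rtrancl_induct) (use assms(2,3) in auto)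

lemma conn_path:
  assumes "(a, b) \<in> conn F"
  obtains xs where "xs \<noteq> []" "distinct xs" "hd xs = a" "last xs = b"
    "\<And>i. Suc i < length xs \<Longrightarrow> {xs ! i, xs ! Suc i} \<in> F"
proof -
  have "\<exists>xs. xs \<noteq> [] \<and> distinct xs \<and> hd xs = a \<and> last xs = b \<and>
    (\<forall>i. Suc i < length xs \<longrightarrow> {xs ! i, xs ! Suc i} \<in> F)"
    using assms unfolding conn_def
  proof (induction rule: rtrancl_induct)
    case base
    show ?case by (rule exI[of _ "[a]"]) simp
  next
    case (step y z)
    then obtain xs where xs: "xs \<noteq> []" "distinct xs" "hd xs = a" "last xs = y"
      "\<forall>i. Suc i < length xs \<longrightarrow> {xs ! i, xs ! Suc i} \<in> F" by blast
    show ?case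
    proof (cases "z \<in> set xs")
      case True
      then obtain i where i: "i < length xs" "xs ! i = z" by (meson in_set_conv_nth)
      let ?ys = "take (Suc i) xs"
      have "last ?ys = z" using i by (simp add: take_Suc_conv_app_nth)
      then show ?thesis using xs i by (intro exI[of _ ?ys]) auto
    next
      case False
      let ?ys = "xs @ [z]"
      have "{?ys ! i, ?ys ! Suc i} \<in> F" if "Suc i < length ?ys" for i
      proof (cases "Suc i < length xs")
        case True
        then show ?thesis using xs by (simp add: nth_append)
      next
        case False
        then have "i = length xs - 1" "Suc i = length xs" using that xs(1) by auto
        then show ?thesis using xs(1,4) step(2) by (auto simp: nth_append last_conv_nth)
      qed
      then show ?thesis using xs False by (intro exI[of _ ?ys]) auto
    qed
  qed
  then show ?thesis using that by blast
qed

text \<open>Two neighbors of \<open>w\<close> that are joined by a path avoiding \<open>w\<close> would close a cycle through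
  \<open>w\<close>.\<close>

lemma forest_detour:
  assumes "forest V E" "F \<subseteq> E" "\<And>e. e \<in> F \<Longrightarrow> w \<notin> e"
    and wa: "{w, a} \<in> E" and wb: "{w, b} \<in> E" and ab: "(a, b) \<in> conn F"
  shows "a = b"
proof (rule ccontr)
  assume "a \<noteq> b"
  from conn_path[OF ab] obtain xs where xs: "xs \<noteq> []" "distinct xs" "hd xs = a" "last xs = b"
    and E: "\<And>i. Suc i < length xs \<Longrightarrow> {xs ! i, xs ! Suc i} \<in> F" by metis
  have len: "2 \<le> length xs"
    using xs \<open>a \<noteq> b\<close> by (cases xs rule: list.exhaust; cases "tl xs") auto
  have "w \<notin> set xs"
  proof
    assume "w \<in> set xs"
    then obtain i where i: "i < length xs" "xs ! i = w" by (meson in_set_conv_nth)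
    show False
    proof (cases "Suc i < length xs")
      case True
      then show False using E[of i] assms(3) i by blast
    next
      case False
      then have "Suc (i - 1) = i" using i len by simp
      then show False using E[of "i - 1"] assms(3) i by (metis insertCI)
    qed
  qed
  have "{(w # xs) ! i, (w # xs) ! (Suc i mod length (w # xs))} \<in> E" if "i < length (w # xs)" for i
  proof (cases i)
    case 0
    then show ?thesis using wa xs by (auto simp: hd_conv_nth mod_less)
  next
    case (Suc m)
    show ?thesis
    proof (cases "Suc i = length (w # xs)")
      case True
      then have "m = length xs - 1" using Suc by simp
      then show ?thesis using True Suc wb xs by (simp add: last_conv_nth insert_commute)
    next
      case False
      then have "Suc m < length xs" using Suc that by simp
      then show ?thesis using E[of m] assms(2) Suc by auto
    qed
  qed
  then have "is_cycle E (w # xs)"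
    unfolding is_cycle_def using xs(2) \<open>w \<notin> set xs\<close> len by auto
  then show False using assms(1) by (auto simp: forest_def)
qed

text \<open>The connection inside \<open>C\<close> that convexity provides avoids \<open>w\<close>.\<close>

lemma one_link:
  assumes "forest V E" "convex E C" "w \<notin> C" "a \<in> C" "b \<in> C" "{w, a} \<in> E" "{w, b} \<in> E"
  shows "a = b"
proof -
  have "(a, b) \<in> conn E"
    using assms(6,7) by (meson conn_edge conn_sym conn_trans)
  then have "(a, b) \<in> conn (inner E C)" using assms by (auto simp: convex_def)
  then show ?thesis
    using forest_detour[of V E "inner E C" w a b] assms by (auto simp: inner_def)
qed

lemma convex_insert:
  assumes C: "convex E C"
    and w: "(\<exists>a\<in>C. {w, a} \<in> E) \<or> (\<forall>a\<in>C. (a, w) \<notin> conn E)"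
  shows "convex E (insert w C)"
proof -
  let ?I = "conn (inner E (insert w C))"
  have up: "(x, y) \<in> conn (inner E C) \<Longrightarrow> (x, y) \<in> ?I" for x y
    using conn_mono[OF inner_mono[of C "insert w C" E]] by auto
  have key: "(w, y) \<in> ?I" if y: "y \<in> C" "(w, y) \<in> conn E" for y
  proof -
    obtain a where a: "a \<in> C" "{w, a} \<in> E" using w y conn_sym[OF y(2)] by blast
    then have "(a, y) \<in> conn E" using y(2) by (meson conn_edge conn_sym conn_trans)
    then have "(a, y) \<in> ?I" using C a y up by (auto simp: convex_def)
    moreover have "(w, a) \<in> ?I" using a by (intro conn_edge) (auto simp: inner_def)
    ultimately show ?thesis by (meson conn_trans)
  qed
  show ?thesis
    unfolding convex_def
  proof (intro ballI impI)
    fix x y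
    assume "x \<in> insert w C" "y \<in> insert w C" "(x, y) \<in> conn E"
    then consider "x = y" | "x = w" "y \<in> C" | "y = w" "x \<in> C" | "x \<in> C" "y \<in> C"
      by blast
    then show "(x, y) \<in> ?I"
      using key up C \<open>(x, y) \<in> conn E\<close>
      by cases (auto simp: convex_def intro: conn_sym)
  qed
qed

lemma simple_graph_edge:
  assumes "simple_graph V E" "e \<in> E"
  obtains x y where "e = {x, y}" "x \<noteq> y" "x \<in> V" "y \<in> V"
proof -
  have "e \<subseteq> V" "card e = 2" using assms by (auto simp: simple_graph_def)
  then obtain x y where "e = {x, y}" "x \<noteq> y" by (meson card_2_iff)
  then show ?thesis using that \<open>e \<subseteq> V\<close> by auto
qed

lemma simple_graph_edge_at:
  assumes "simple_graph V E" "e \<in> E" "x \<in> e"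
  obtains y where "e = {x, y}" "x \<noteq> y" "x \<in> V" "y \<in> V"
proof -
  obtain u v where "e = {u, v}" "u \<noteq> v" "u \<in> V" "v \<in> V" using simple_graph_edge[OF assms(1,2)] .
  then show ?thesis using assms(3) that[of u] that[of v] by (auto simp: insert_commute)
qed

lemma simple_graph_finite_edges: "simple_graph V E \<Longrightarrow> finite E"
  unfolding simple_graph_def by (meson PowI finite_Pow_iff finite_subset subsetI)

lemma degree_pos_edge:
  assumes "simple_graph V E" "0 < degree E u"
  obtains z where "{u, z} \<in> E" "z \<in> V" "z \<noteq> u"
proof -
  have "{e \<in> E. u \<in> e} \<noteq> {}" using assms(2) unfolding degree_def by (metis card.empty less_irrefl)
  then obtain e where e: "e \<in> E" "u \<in> e" by blast
  then obtain z where "e = {u, z}" "u \<noteq> z" using simple_graph_edge_at[OF assms(1)] by metis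
  then show ?thesis using that e assms(1) by (auto simp: simple_graph_def)
qed

text \<open>Build up \<open>V\<close> from a single vertex through convex sets: by \<open>one_link\<close> each new vertex
  contributes at most one edge.\<close>

lemma card_edges_forest:
  assumes "forest V E" "V \<noteq> {}"
  shows "card E < card V"
proof -
  have sg: "simple_graph V E" and fin: "finite V" and finE: "finite E"
    using assms simple_graph_finite_edges by (auto simp: forest_def simple_graph_def)
  have "card E < card V" if "convex E C" "C \<subseteq> V" "card (inner E C) < card C" for C
    using that
  proof (induction "card (V - C)" arbitrary: C)
    case 0
    then have "C = V" using fin by auto
    moreover have "inner E V = E" using sg by (auto simp: inner_def simple_graph_def)
    ultimately show ?case using 0 by simp
  next
    case (Suc m)
    obtain w where w: "w \<in> V - C" "(\<exists>a\<in>C. {w, a} \<in> E) \<or> (\<forall>a\<in>C. (a, w) \<notin> conn E)"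
    proof (cases "\<exists>w\<in>V - C. \<exists>a\<in>C. {w, a} \<in> E")
      case True
      then show ?thesis using that by blast
    next
      case False
      have "V - C \<noteq> {}" using Suc(2) by (metis card.empty nat.distinct(1))
      then obtain w where w: "w \<in> V - C" by blast
      have "b \<in> C" if "a \<in> C" "{a, b} \<in> E" for a b
      proof -
        have "b \<in> V" using that sg by (auto simp: simple_graph_def)
        then show ?thesis using False that by (metis DiffI insert_commute)
      qed
      then have "(a, w) \<notin> conn E" if "a \<in> C" for a
        using conn_closed[of a w E C] that w by blast
      then show ?thesis using that w by blast
    qed
    have fC: "finite C" using Suc.prems(2) fin finite_subset by blast
    have new: "e = f" if "e \<in> inner E (insert w C) - inner E C" "f \<in> inner E (insert w C) - inner E C" for e f
    proof -
      have ew: "w \<in> e" "w \<in> f" "e \<in> E" "f \<in> E" "e \<subseteq> insert w C" "f \<subseteq> insert w C"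
        using that by (auto simp: inner_def)
      obtain a where a: "e = {w, a}" "w \<noteq> a" using simple_graph_edge_at[OF sg] ew by metis
      obtain b where b: "f = {w, b}" "w \<noteq> b" using simple_graph_edge_at[OF sg] ew by metis
      have "a = b" using one_link[OF assms(1) Suc.prems(1), of w a b] a b ew w by auto
      then show ?thesis using a b by simp
    qed
    have "card (inner E (insert w C) - inner E C) \<le> Suc 0"
      using new finE by (subst card_le_Suc0_iff_eq) (auto simp: inner_def)
    moreover have "card (inner E (insert w C) - inner E C) = card (inner E (insert w C)) - card (inner E C)"
      using inner_mono[of C "insert w C" E] finE by (intro card_Diff_subset) (auto simp: inner_def)
    ultimately have "card (inner E (insert w C)) < card (insert w C)"
      using Suc.prems(3) w fC by simp
    moreover have "m = card (V - insert w C)"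
      using Suc(2) w fin by (metis Diff_insert card_Diff_singleton diff_Suc_1)
    ultimately show ?case
      using Suc.hyps(1)[of "insert w C"] convex_insert[OF Suc.prems(1) w(2)] w Suc.prems(2) by blast
  qed
  moreover obtain v where "v \<in> V" using assms(2) by blast
  moreover have "inner E {v} = {}" using sg
    by (auto simp: inner_def simple_graph_def subset_singleton_iff)
  moreover have "convex E {v}" by (simp add: convex_def)
  ultimately show ?thesis by simp
qed

section \<open>Extending a partial coloring by one vertex\<close>

lemma inner_insert:
  assumes "simple_graph V E" "e \<in> inner E (insert w C)" "e \<notin> inner E C" "w \<notin> C"
  obtains p where "p \<in> C" "e = {w, p}" "e \<in> E"
proof -
  have "e \<in> E" "w \<in> e" "e \<subseteq> insert w C" using assms by (auto simp: inner_def)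
  then obtain p where "e = {w, p}" "w \<noteq> p" using simple_graph_edge_at[OF assms(1)] by metis
  then show ?thesis using that \<open>e \<in> E\<close> \<open>e \<subseteq> insert w C\<close> by auto
qed

text \<open>The size of this set is the load of the color \<open>a\<close>.  In a proper coloring it equals the sum
  of the full degrees of the vertices in the class of \<open>a\<close>, so it already reserves
  room for their uncolored neighbors.\<close>

definition touch :: "'a set set \<Rightarrow> 'a set \<Rightarrow> ('a \<Rightarrow> nat) \<Rightarrow> nat \<Rightarrow> 'a set set" where
  "touch E C c a = {e \<in> E. \<exists>u\<in>e. u \<in> C \<and> c u = a}"

text \<open>The forest that is left after the deletion of a vertex of maximum degree, with the colors
  that may be used on it.\<close>

locale palette =
  fixes V :: "'a set" and E :: "'a set set" and A :: "nat set" and k :: nat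
  assumes forest: "forest V E"
    and few_edges: "card E + 3 \<le> 2 * k"
    and degree_less: "u \<in> V \<Longrightarrow> degree E u < k"
    and finite_palette: "finite A"
    and card_palette: "card A = k"
begin

lemma simple: "simple_graph V E" and finite_V: "finite V" and finite_E: "finite E"
  using forest simple_graph_finite_edges by (auto simp: forest_def simple_graph_def)

text \<open>The last condition reserves, for every edge touching the class of \<open>a\<close>, a color different
  from \<open>a\<close> for its other end.\<close>

definition good :: "'a set \<Rightarrow> ('a \<Rightarrow> nat) \<Rightarrow> bool" where
  "good C c \<longleftrightarrow> C \<subseteq> V \<and> c ` C \<subseteq> A \<and> harmonious_coloring C (inner E C) c \<and>
     (\<forall>a\<in>A. card (touch E C c a) < k)"

text \<open>Two colors are already joined by an edge exactly if their sets of touched edges meet,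
  because only an edge with both ends colored touches two classes.\<close>

definition fits :: "'a set \<Rightarrow> ('a \<Rightarrow> nat) \<Rightarrow> 'a \<Rightarrow> nat \<Rightarrow> bool" where
  "fits C c w a \<longleftrightarrow> a \<in> A \<and> card (touch E C c a) + degree E w < k \<and>
     (\<forall>p\<in>C. {w, p} \<in> E \<longrightarrow> c p \<noteq> a \<and> touch E C c (c p) \<inter> touch E C c a = {})"

definition one_linked :: "'a set \<Rightarrow> 'a \<Rightarrow> bool" where
  "one_linked C w \<longleftrightarrow> (\<forall>p\<in>C. \<forall>q\<in>C. {w, p} \<in> E \<longrightarrow> {w, q} \<in> E \<longrightarrow> p = q)"

text \<open>A component with an edge has at least two leaves.  So no such component gets fully colored
  as long as only vertices of degree at least two are added to a start set of pairwise unconnected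
  vertices.\<close>

definition open_ended :: "'a set \<Rightarrow> bool" where
  "open_ended C \<longleftrightarrow> (\<forall>y\<in>C. 0 < degree E y \<longrightarrow>
     (\<exists>x\<in>C. (y, x) \<in> conn (inner E C) \<and> (\<exists>z\<in>V - C. {x, z} \<in> E)))"

text \<open>The invariant while vertices of degree at least two are being colored.  The cardinality
  condition bounds the number of colors in use by the number of touched edges.\<close>

definition growing :: "'a set \<Rightarrow> bool" where
  "growing C \<longleftrightarrow> convex E C \<and> open_ended C \<and>
     card {u \<in> C. 0 < degree E u} \<le> card {e \<in> E. e \<inter> C \<noteq> {}}"

lemma good_proper:
  "good C c \<Longrightarrow> u \<in> C \<Longrightarrow> v \<in> C \<Longrightarrow> {u, v} \<in> E \<Longrightarrow> c u \<noteq> c v"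
  by (auto simp: good_def harmonious_coloring_def inner_def)

lemma good_distinct:
  "good C c \<Longrightarrow> e \<in> E \<Longrightarrow> e \<subseteq> C \<Longrightarrow> f \<in> E \<Longrightarrow> f \<subseteq> C \<Longrightarrow> c ` e = c ` f \<Longrightarrow> e = f"
  by (auto simp: good_def harmonious_coloring_def inner_def)

lemma finite_touch: "finite (touch E C c a)"
  using finite_E by (simp add: touch_def)

lemma touch_both:
  assumes "e \<in> touch E C c a" "e \<in> touch E C c b" "a \<noteq> b"
  obtains x y where "e = {x, y}" "x \<in> C" "y \<in> C" "c x = a" "c y = b" "e \<in> E"
proof -
  obtain x y where xy: "x \<in> e" "x \<in> C" "c x = a" "y \<in> e" "y \<in> C" "c y = b" "e \<in> E"
    using assms by (auto simp: touch_def)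
  then obtain z where "e = {x, z}" using simple_graph_edge_at[OF simple] by metis
  then show ?thesis using that xy assms(3) by auto
qed

lemma load_sum:
  assumes g: "good C c"
  shows "card (touch E C c a) = (\<Sum>x | x \<in> C \<and> c x = a. degree E x)"
proof -
  let ?S = "{x. x \<in> C \<and> c x = a}"
  have fS: "finite ?S" using g finite_V by (auto simp: good_def intro: finite_subset)
  have disj: "{e \<in> E. x \<in> e} \<inter> {e \<in> E. y \<in> e} = {}" if xy: "x \<in> ?S" "y \<in> ?S" "x \<noteq> y" for x y
  proof (rule equals0I)
    fix e assume "e \<in> {e \<in> E. x \<in> e} \<inter> {e \<in> E. y \<in> e}"
    then have e: "e \<in> E" "x \<in> e" "y \<in> e" by auto
    then obtain z where "e = {x, z}" using simple_graph_edge_at[OF simple e(1,2)] by metis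
    then have "{x, y} \<in> E" using e xy(3) by auto
    then show False using good_proper[OF g, of x y] xy by auto
  qed
  have "touch E C c a = (\<Union>x\<in>?S. {e \<in> E. x \<in> e})" by (auto simp: touch_def)
  then show ?thesis
    unfolding degree_def using fS finite_E disj by (simp add: card_UN_disjoint)
qed

lemma good_insert:
  assumes g: "good C c" and w: "w \<in> V - C" and one: "one_linked C w" and fit: "fits C c w a"
  shows "good (insert w C) (c(w := a))"
proof -
  let ?C = "insert w C" and ?c = "c(w := a)"
  have old: "?c u = c u" if "u \<in> C" for u using that w by auto
  have new: "\<exists>p\<in>C. e = {w, p} \<and> e \<in> E" if "e \<in> inner E ?C" "e \<notin> inner E C" for e
    using inner_insert[OF simple that] w by blast
  have oldim: "?c ` e = c ` e" if "e \<in> inner E C" for e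
    using that old by (auto simp: inner_def image_iff) force+
  have proper: "?c u \<noteq> ?c v" if uv: "u \<in> ?C" "v \<in> ?C" "{u, v} \<in> inner E ?C" for u v
  proof -
    have e: "{u, v} \<in> E" using uv by (auto simp: inner_def)
    then have "u \<noteq> v" using simple by (auto simp: simple_graph_def)
    then consider "u = w" "v \<in> C" | "v = w" "u \<in> C" | "u \<in> C" "v \<in> C" using uv by blast
    then show ?thesis
    proof cases
      case 1
      then show ?thesis using fit e old w by (auto simp: fits_def)
    next
      case 2
      then show ?thesis using fit e old w by (auto simp: fits_def insert_commute)
    next
      case 3
      then show ?thesis using good_proper[OF g] e old by simp
    qed
  qed
  have clash: False
    if p: "p \<in> C" "{w, p} \<in> E" and f: "f \<in> inner E C" and eq: "?c ` {w, p} = c ` f" for p f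
  proof -
    have f': "f \<in> E" "f \<subseteq> C" using f by (auto simp: inner_def)
    have "{a, c p} = c ` f" using eq p w by auto
    then have "a \<in> c ` f" "c p \<in> c ` f" by auto
    then have "f \<in> touch E C c (c p) \<inter> touch E C c a" using f' by (auto simp: touch_def)
    then show False using fit p by (auto simp: fits_def)
  qed
  have distinct: "?c ` e \<noteq> ?c ` f" if ef': "e \<in> inner E ?C" "f \<in> inner E ?C" "e \<noteq> f" for e f
  proof (cases "e \<in> inner E C"; cases "f \<in> inner E C")
    assume "e \<in> inner E C" "f \<in> inner E C"
    then show ?thesis using good_distinct[OF g] ef'(3) oldim by (auto simp: inner_def)
  next
    assume ef: "e \<in> inner E C" "f \<notin> inner E C"
    then obtain p where p: "p \<in> C" "f = {w, p}" "f \<in> E" using new ef' by blast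
    then show ?thesis using clash[of p e] oldim[OF ef(1)] ef by metis
  next
    assume ef: "e \<notin> inner E C" "f \<in> inner E C"
    then obtain p where p: "p \<in> C" "e = {w, p}" "e \<in> E" using new ef' by blast
    then show ?thesis using clash[of p f] oldim[OF ef(2)] ef by metis
  next
    assume "e \<notin> inner E C" "f \<notin> inner E C"
    then obtain p q where "p \<in> C" "e = {w, p}" "e \<in> E" "q \<in> C" "f = {w, q}" "f \<in> E"
      using new ef' by meson
    then show ?thesis using one ef'(3) by (auto simp: one_linked_def)
  qed
  have load: "card (touch E ?C ?c b) < k" if b: "b \<in> A" for b
  proof (cases "b = a")
    case True
    have "touch E ?C ?c b \<subseteq> touch E C c a \<union> {e \<in> E. w \<in> e}"
      using old True by (auto simp: touch_def)
    then have "card (touch E ?C ?c b) \<le> card (touch E C c a \<union> {e \<in> E. w \<in> e})"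
      using finite_E by (intro card_mono) (auto simp: touch_def)
    also have "\<dots> \<le> card (touch E C c a) + degree E w"
      unfolding degree_def by (rule card_Un_le)
    finally show ?thesis using fit by (simp add: fits_def)
  next
    case False
    then have "touch E ?C ?c b = touch E C c b"
      using w unfolding touch_def by fastforce
    then show ?thesis using g b by (simp add: good_def)
  qed
  show ?thesis
    unfolding good_def harmonious_coloring_def
    using g w fit proper distinct load by (auto simp: good_def fits_def)
qed

text \<open>By \<open>one_link\<close> the new vertex has at most one colored neighbor, so having degree at least two
  it has an uncolored neighbor \<open>z\<close>.  The edge to \<open>z\<close> leaves the colored part and was not touched
  before, which gives both the cardinality condition and the new way out of the colored part.\<close>

lemma growing_insert:
  assumes gr: "growing C" and w: "w \<in> V - C" "2 \<le> degree E w" and CV: "C \<subseteq> V"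
    and link: "(\<exists>p\<in>C. {w, p} \<in> E) \<or> (\<forall>p\<in>C. (p, w) \<notin> conn E)"
  shows "growing (insert w C)"
proof -
  let ?C = "insert w C"
  have cv: "convex E C" and oe: "open_ended C"
    and cnt: "card {u \<in> C. 0 < degree E u} \<le> card {e \<in> E. e \<inter> C \<noteq> {}}"
    using gr by (auto simp: growing_def)
  have up: "(x, y) \<in> conn (inner E C) \<Longrightarrow> (x, y) \<in> conn (inner E ?C)" for x y
    using conn_mono[OF inner_mono[of C ?C E]] by auto
  have "\<exists>z\<in>V - ?C. {w, z} \<in> E"
  proof (rule ccontr)
    assume none: "\<not> ?thesis"
    have ends: "\<forall>e\<in>{e \<in> E. w \<in> e}. \<exists>p\<in>C. e = {w, p}"
    proof
      fix e assume e: "e \<in> {e \<in> E. w \<in> e}"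
      then obtain z where "e = {w, z}" "w \<noteq> z" "z \<in> V"
        using simple_graph_edge_at[OF simple, of e w] by blast
      then show "\<exists>p\<in>C. e = {w, p}" using none e by auto
    qed
    have "e = f" if ef: "e \<in> {e \<in> E. w \<in> e}" "f \<in> {e \<in> E. w \<in> e}" for e f
    proof -
      obtain p where p: "p \<in> C" "e = {w, p}" using ends ef by meson
      obtain q where q: "q \<in> C" "f = {w, q}" using ends ef by meson
      have "p = q" by (rule one_link[OF forest cv, of w]) (use p q ef w in auto)
      then show ?thesis using p q by simp
    qed
    then have "card {e \<in> E. w \<in> e} \<le> Suc 0"
      using finite_E by (subst card_le_Suc0_iff_eq) auto
    then show False using w by (simp add: degree_def)
  qed
  then obtain z where z: "z \<in> V - ?C" "{w, z} \<in> E" by blast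
  have "convex E ?C" using convex_insert[OF cv link] .
  moreover have "open_ended ?C"
    unfolding open_ended_def
  proof (intro ballI impI)
    fix y assume y: "y \<in> ?C" "0 < degree E y"
    show "\<exists>x\<in>?C. (y, x) \<in> conn (inner E ?C) \<and> (\<exists>z\<in>V - ?C. {x, z} \<in> E)"
    proof (cases "y = w")
      case True
      then show ?thesis using z by (intro bexI[of _ w]) auto
    next
      case False
      then obtain x u where x: "x \<in> C" "(y, x) \<in> conn (inner E C)" "u \<in> V - C" "{x, u} \<in> E"
        using oe y by (auto simp: open_ended_def)
      show ?thesis
      proof (cases "u = w")
        case True
        then have "(x, w) \<in> conn (inner E ?C)" using x by (intro conn_edge) (auto simp: inner_def)
        then have "(y, w) \<in> conn (inner E ?C)" using up[OF x(2)] by (meson conn_trans)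
        then show ?thesis using z by (intro bexI[of _ w]) auto
      next
        case False
        then show ?thesis using x up[OF x(2)] by (intro bexI[of _ x]) auto
      qed
    qed
  qed
  moreover have "card {u \<in> ?C. 0 < degree E u} \<le> card {e \<in> E. e \<inter> ?C \<noteq> {}}"
  proof -
    have fC: "finite C" using CV finite_V finite_subset by blast
    have "{u \<in> ?C. 0 < degree E u} = insert w {u \<in> C. 0 < degree E u}" using w by auto
    then have "card {u \<in> ?C. 0 < degree E u} = Suc (card {u \<in> C. 0 < degree E u})"
      using w fC by simp
    also have "\<dots> \<le> Suc (card {e \<in> E. e \<inter> C \<noteq> {}})" using cnt by simp
    also have "\<dots> = card (insert {w, z} {e \<in> E. e \<inter> C \<noteq> {}})"
      using finite_E w z by (subst card_insert_disjoint) auto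
    also have "\<dots> \<le> card {e \<in> E. e \<inter> ?C \<noteq> {}}"
      using finite_E z by (intro card_mono) auto
    finally show ?thesis .
  qed
  ultimately show ?thesis by (simp add: growing_def)
qed

text \<open>Double counting: an edge touches at most as many classes as it has colored ends.\<close>

lemma sum_loads:
  "(\<Sum>a\<in>A. card (touch E C c a)) \<le>
    2 * card (inner E C) + card ({e \<in> E. e \<inter> C \<noteq> {}} - inner E C)"
proof -
  let ?T = "{e \<in> E. e \<inter> C \<noteq> {}}"
  have "(\<Sum>a\<in>A. card (touch E C c a)) = (\<Sum>a\<in>A. \<Sum>e\<in>?T. of_bool (e \<in> touch E C c a))"
  proof (rule sum.cong[OF refl])
    fix a
    have "(\<Sum>e\<in>?T. of_bool (e \<in> touch E C c a)) = card (?T \<inter> touch E C c a)"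
      using finite_E by (simp add: of_bool_def sum.If_cases Int_def)
    moreover have "?T \<inter> touch E C c a = touch E C c a" by (auto simp: touch_def)
    ultimately show "card (touch E C c a) = (\<Sum>e\<in>?T. of_bool (e \<in> touch E C c a))" by simp
  qed
  also have "\<dots> = (\<Sum>e\<in>?T. \<Sum>a\<in>A. of_bool (e \<in> touch E C c a))" by (rule sum.swap)
  also have "\<dots> = (\<Sum>e\<in>?T. card {a \<in> A. e \<in> touch E C c a})"
    using finite_palette by (simp add: of_bool_def sum.If_cases Int_def)
  also have "\<dots> \<le> (\<Sum>e\<in>?T. if e \<in> inner E C then 2 else 1)"
  proof (rule sum_mono)
    fix e assume e: "e \<in> ?T"
    then have e2: "finite e" "card e = 2" using simple
      by (auto simp: simple_graph_def intro: card_ge_0_finite)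
    have "card {a \<in> A. e \<in> touch E C c a} \<le> card (c ` (e \<inter> C))"
      using e2 by (intro card_mono) (auto simp: touch_def)
    also have "\<dots> \<le> card (e \<inter> C)" using e2 by (intro card_image_le) auto
    also have "\<dots> \<le> (if e \<in> inner E C then 2 else 1)"
    proof (cases "e \<subseteq> C")
      case True
      then show ?thesis using e e2 by (auto simp: inner_def Int_absorb2)
    next
      case False
      then have "card (e \<inter> C) < card e" using e2 by (intro psubset_card_mono) auto
      then show ?thesis using e2 False by (auto simp: inner_def)
    qed
    finally show "card {a \<in> A. e \<in> touch E C c a} \<le> (if e \<in> inner E C then 2 else 1)" .
  qed
  also have "\<dots> = 2 * card (?T \<inter> inner E C) + card (?T - inner E C)"
    using finite_E by (simp add: sum.If_cases Int_def set_diff_eq)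
  also have "\<dots> \<le> 2 * card (inner E C) + card (?T - inner E C)"
    using finite_E by (simp add: card_mono inner_def)
  finally show ?thesis .
qed

text \<open>The edges at \<open>w\<close> that lead to uncolored vertices are invisible to all loads.\<close>

lemma touched_plus_hidden:
  "card {e \<in> E. e \<inter> C \<noteq> {}} + card {e \<in> E. w \<in> e \<and> e \<inter> C = {}} \<le> card E"
proof -
  have "card {e \<in> E. e \<inter> C \<noteq> {}} + card {e \<in> E. w \<in> e \<and> e \<inter> C = {}} =
    card ({e \<in> E. e \<inter> C \<noteq> {}} \<union> {e \<in> E. w \<in> e \<and> e \<inter> C = {}})"
    using finite_E by (subst card_Un_disjoint) auto
  also have "\<dots> \<le> card E" using finite_E by (intro card_mono) auto
  finally show ?thesis .
qed

lemma touched_split: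
  "card {e \<in> E. e \<inter> C \<noteq> {}} =
    card (inner E C) + card ({e \<in> E. e \<inter> C \<noteq> {}} - inner E C)"
proof -
  have "inner E C \<subseteq> {e \<in> E. e \<inter> C \<noteq> {}}"
  proof
    fix e assume "e \<in> inner E C"
    then show "e \<in> {e \<in> E. e \<inter> C \<noteq> {}}"
      using simple_graph_edge[OF simple, of e] by (auto simp: inner_def)
  qed
  then show ?thesis using finite_E
    by (simp add: card_Diff_subset card_mono finite_subset[of "inner E C" E] inner_def)
qed

text \<open>Distinct colors of positive load are seen at distinct colored vertices that have an edge.\<close>

lemma loaded_colors:
  assumes CV: "C \<subseteq> V" and all: "\<forall>a\<in>A. 0 < card (touch E C c a)"
  shows "k \<le> card {u \<in> C. 0 < degree E u}"
proof -
  have fC: "finite C" using CV finite_V finite_subset by blast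
  have "A \<subseteq> c ` {u \<in> C. 0 < degree E u}"
  proof
    fix a assume "a \<in> A"
    then obtain e where "e \<in> touch E C c a" using all by (metis card.empty ex_in_conv less_irrefl)
    then obtain u where u: "e \<in> E" "u \<in> e" "u \<in> C" "c u = a" by (auto simp: touch_def)
    then have "0 < degree E u" using finite_E by (auto simp: degree_def card_gt_0_iff)
    then show "a \<in> c ` {u \<in> C. 0 < degree E u}" using u by auto
  qed
  then have "card A \<le> card (c ` {u \<in> C. 0 < degree E u})" using fC by (intro card_mono) auto
  also have "\<dots> \<le> card {u \<in> C. 0 < degree E u}" using fC by (intro card_image_le) auto
  finally show ?thesis using card_palette by simp
qed

section \<open>Every vertex finds a fitting color\<close>

text \<open>Without a colored neighbor, the only obstacle is the load: if nothing fits, then each of the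
  \<open>k\<close> loads is at least \<open>k - degree w\<close>, while \<open>degree w\<close> of the at most \<open>2 k - 3\<close> edges are still
  hidden.  By \<open>sum_loads\<close> this is impossible unless \<open>degree w = k - 1\<close>.  In that case every color is in
  use, which needs at least \<open>k\<close> touched edges; but at most \<open>k - 2\<close> are left for that.  The
  leaf \<open>w\<close> with \<open>k = 2\<close> is settled by \<open>sum_loads\<close> again, since its edge is the only one.\<close>

lemma fit_unlinked:
  assumes g: "good C c" and w: "w \<in> V - C" and no: "\<not> (\<exists>p\<in>C. {w, p} \<in> E)"
    and gr: "2 \<le> degree E w \<Longrightarrow> growing C"
  shows "\<exists>a. fits C c w a"
proof (rule ccontr)
  assume none: "\<not> ?thesis"
  define d where "d = degree E w"
  define T where "T = {e \<in> E. e \<inter> C \<noteq> {}}"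
  let ?L = "\<lambda>a. card (touch E C c a)"
  have CV: "C \<subseteq> V" using g by (simp add: good_def)
  have full: "k \<le> ?L a + d" if "a \<in> A" for a
    using none that no by (auto simp: fits_def d_def not_less)
  have dk: "d < k" using degree_less w by (simp add: d_def)
  have "e \<inter> C = {}" if e: "e \<in> E" "w \<in> e" for e
  proof -
    obtain q where "e = {w, q}" using simple_graph_edge_at[OF simple e] by metis
    then show ?thesis using no w e(1) by auto
  qed
  then have "{e \<in> E. w \<in> e \<and> e \<inter> C = {}} = {e \<in> E. w \<in> e}" by blast
  then have T: "card T + d \<le> card E"
    using touched_plus_hidden[of C w] by (simp add: T_def d_def degree_def)
  have "k * (k - d) \<le> (\<Sum>a\<in>A. ?L a)"
    using sum_bounded_below[of A "k - d" ?L] full card_palette by force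
  also have "\<dots> \<le> 2 * card T"
    using sum_loads[of C c] touched_split[of C] by (simp add: T_def)
  finally have S: "k * (k - d) \<le> 2 * card T" .
  obtain y where y: "k = d + Suc y" using dk by (metis add_Suc_right less_imp_Suc_add)
  show False
  proof (cases y)
    case (Suc x)
    have "(k - 2) * x + 2 * k + 2 * x = k * (x + 2)"
      using few_edges by (cases k; cases "k - 1") (auto simp: algebra_simps)
    moreover have "k - d = x + 2" using y Suc by simp
    ultimately have "2 * k + 2 * x \<le> 2 * card T" using S by simp
    then show False using T few_edges y Suc by simp
  next
    case 0
    show False
    proof (cases "2 \<le> d")
      case True
      then have "card {u \<in> C. 0 < degree E u} \<le> card T"
        using gr by (simp add: growing_def T_def d_def)
      moreover have "\<forall>a\<in>A. 0 < ?L a" using full dk by (metis add_cancel_left_left not_gr0 not_less)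
      ultimately show False using loaded_colors[OF CV, of c] T few_edges y 0 by simp
    next
      case False
      then show False using S T few_edges y 0 by simp
    qed
  qed
qed

text \<open>The central counting argument.  Let \<open>b\<close> be the color of the colored neighbor \<open>p\<close> of \<open>w\<close>,
  \<open>U\<close> the colors already joined to \<open>b\<close>, and \<open>Q\<close> the other colors different from \<open>b\<close>.
  If no color fits, then every color in \<open>Q\<close> has load at least \<open>k - d\<close>, where \<open>d\<close> is the degree of
  \<open>w\<close>.  The set \<open>Q\<close> is not empty because the load of \<open>b\<close> is below \<open>k\<close> and counts the edge
  to \<open>w\<close>.  If \<open>Q\<close> is a singleton, then \<open>b\<close> has load \<open>k - 1\<close>, and the touched edges of
  both colors together with the hidden edges at \<open>w\<close> are too many.  The remaining cases
  depend on \<open>d\<close>.\<close>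

lemma fit_linked:
  assumes g: "good C c" and w: "w \<in> V - C" and p: "p \<in> C" "{w, p} \<in> E"
    and one: "one_linked C w" and gr: "2 \<le> degree E w \<Longrightarrow> growing C"
  shows "\<exists>a. fits C c w a"
proof (rule ccontr)
  assume none: "\<not> ?thesis"
  define d where "d = degree E w"
  define b where "b = c p"
  define T where "T = {e \<in> E. e \<inter> C \<noteq> {}}"
  \<comment> \<open>the edges leaving the colored part\<close>
  define F where "F = T - inner E C"
  \<comment> \<open>the edges at \<open>w\<close> other than the one to \<open>p\<close>\<close>
  define H where "H = {e \<in> E. w \<in> e \<and> e \<inter> C = {}}"
  define X where "X = touch E C c"
  define U where "U = {a \<in> A. a \<noteq> b \<and> X b \<inter> X a \<noteq> {}}"
  define Q where "Q = {a \<in> A. a \<noteq> b \<and> X b \<inter> X a = {}}"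
  have CV: "C \<subseteq> V" using g by (simp add: good_def)
  have bA: "b \<in> A" using g p by (auto simp: good_def b_def)
  have fin: "finite U" "finite Q" "finite (X a)" "finite F" "finite H" "finite T" for a
    using finite_palette finite_E
    by (auto simp: U_def Q_def X_def F_def T_def H_def finite_touch)
  have wC: "w \<notin> C" using w by simp
  have full: "k \<le> card (X a) + d" if "a \<in> Q" for a
  proof -
    have "\<not> fits C c w a" using none by blast
    moreover have "c q \<noteq> a \<and> touch E C c (c q) \<inter> touch E C c a = {}"
      if "q \<in> C" "{w, q} \<in> E" for q
    proof -
      have "q = p" using one p that by (simp add: one_linked_def)
      then show ?thesis using \<open>a \<in> Q\<close> by (simp add: Q_def b_def X_def)
    qed
    ultimately show ?thesis using \<open>a \<in> Q\<close> by (auto simp: fits_def X_def d_def Q_def)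
  qed
  have dk: "d < k" using degree_less w by (simp add: d_def)
  have star: "{e \<in> E. w \<in> e} = insert {w, p} H"
  proof (rule set_eqI, rule iffI)
    fix e assume "e \<in> {e \<in> E. w \<in> e}"
    then obtain q where q: "e = {w, q}" "e \<in> E"
      using simple_graph_edge_at[OF simple, of e w] by blast
    show "e \<in> insert {w, p} H"
    proof (cases "q \<in> C")
      case True
      then have "q = p" using one p q by (simp add: one_linked_def)
      then show ?thesis using q by simp
    next
      case False
      then show ?thesis using q wC by (auto simp: H_def)
    qed
  qed (use p in \<open>auto simp: H_def\<close>)
  have dH: "d = Suc (card H)"
    unfolding d_def degree_def star using p fin by (subst card_insert_disjoint) (auto simp: H_def)
  have e0: "{w, p} \<in> X b - inner E C"
    using p wC by (auto simp: X_def touch_def b_def inner_def)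
  have Lb: "card (X b) < k" using g bA by (simp add: good_def X_def)
  have split_b: "card (X b) = card (X b \<inter> inner E C) + card (X b - inner E C)"
    using card_Int_Diff fin by blast
  have XT: "X a \<subseteq> T" for a by (auto simp: X_def touch_def T_def)
  have rF: "card (X b - inner E C) \<le> card F"
    using XT fin by (intro card_mono) (auto simp: F_def)
  have r: "1 \<le> card (X b - inner E C)"
    using e0 fin by (metis One_nat_def Suc_leI card_gt_0_iff empty_iff finite_Diff)
  have U: "card U \<le> card (X b \<inter> inner E C)"
  proof -
    have "U \<subseteq> (\<Union>e\<in>X b \<inter> inner E C. c ` e - {b})"
    proof
      fix a assume "a \<in> U"
      then obtain e where e: "e \<in> X b" "e \<in> X a" "a \<noteq> b" by (auto simp: U_def)
      then obtain x y where "e = {x, y}" "x \<in> C" "y \<in> C" "c x = b" "c y = a" "e \<in> E"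
        using touch_both[of e C c b a] unfolding X_def by metis
      then show "a \<in> (\<Union>e\<in>X b \<inter> inner E C. c ` e - {b})"
        using e by (intro UN_I[of e]) (auto simp: inner_def)
    qed
    moreover have fe: "finite e \<and> card e = 2" if "e \<in> E" for e
      using simple that by (auto simp: simple_graph_def intro: card_ge_0_finite)
    then have "finite (\<Union>e\<in>X b \<inter> inner E C. c ` e - {b})"
      using fin by (intro finite_UN_I) (auto simp: inner_def)
    ultimately have "card U \<le> card (\<Union>e\<in>X b \<inter> inner E C. c ` e - {b})"
      by (intro card_mono)
    also have "\<dots> \<le> (\<Sum>e\<in>X b \<inter> inner E C. card (c ` e - {b}))"
      using fin by (intro card_UN_le) auto
    also have "\<dots> \<le> (\<Sum>e\<in>X b \<inter> inner E C. 1)"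
    proof (rule sum_mono)
      fix e assume e: "e \<in> X b \<inter> inner E C"
      then have "b \<in> c ` e" "e \<in> E" by (auto simp: X_def touch_def)
      moreover have "card (c ` e) \<le> 2"
        using fe[OF \<open>e \<in> E\<close>] card_image_le[of e c] by simp
      ultimately show "card (c ` e - {b}) \<le> 1" by simp
    qed
    finally show ?thesis by simp
  qed
  have "A = insert b (U \<union> Q)" using bA by (auto simp: U_def Q_def)
  moreover have disj: "U \<inter> Q = {}" "b \<notin> U \<union> Q" by (auto simp: U_def Q_def)
  ultimately have kUQ: "k = Suc (card U + card Q)"
    and sumA: "(\<Sum>a\<in>A. card (X a)) = card (X b) + (\<Sum>a\<in>U. card (X a)) + (\<Sum>a\<in>Q. card (X a))"
    using card_palette fin by (auto simp: card_Un_disjoint sum.union_disjoint)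
  have Tm: "card T + card H \<le> card E"
    using touched_plus_hidden[of C w] by (simp add: T_def H_def)
  have TF: "card T = card (inner E C) + card F"
    using touched_split[of C] by (simp add: T_def F_def)
  have S: "card (X b) + (\<Sum>a\<in>U. card (X a)) + (\<Sum>a\<in>Q. card (X a)) \<le> 2 * card (inner E C) + card F"
    using sum_loads[of C c] sumA by (simp add: X_def T_def F_def)
  have Upos: "1 \<le> card (X a)" if "a \<in> U" for a
    using that fin by (auto simp: U_def Suc_le_eq card_gt_0_iff)
  have SU: "card U \<le> (\<Sum>a\<in>U. card (X a))"
    using sum_bounded_below[of U 1 "\<lambda>a. card (X a)"] Upos by simp
  have SQ: "card Q * (k - d) \<le> (\<Sum>a\<in>Q. card (X a))"
    using sum_bounded_below[of Q "k - d" "\<lambda>a. card (X a)"] full by force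
  have HX: "H \<inter> X a = {}" for a by (auto simp: H_def X_def touch_def)
  consider "card Q = 0" | "card Q = 1" | "card Q = 2" "d < k - 1" | "2 \<le> card Q" "d = k - 1"
    | "3 \<le> card Q" "d = k - 2" | "3 \<le> card Q" "d < k - 2"
    using dk by linarith
  then show False
  proof cases
    case 1
    then show False using kUQ U split_b r Lb by linarith
  next
    case 2
    then obtain a where a: "Q = {a}" by (auto simp: card_1_singleton_iff)
    have "card (X a \<union> X b \<union> H) \<le> card E"
      using finite_E by (intro card_mono) (auto simp: X_def touch_def H_def)
    moreover have "card (X a \<union> X b \<union> H) = card (X a) + card (X b) + card H"
    proof -
      have "X a \<inter> X b = {}" using a by (auto simp: Q_def)
      then show ?thesis using HX[of a] HX[of b] fin by (subst card_Un_disjoint; auto simp: card_Un_disjoint)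
    qed
    ultimately show False using full[of a] a kUQ 2 U split_b r few_edges dH by simp
  next
    case 3
    then obtain a a' where a: "Q = {a, a'}" "a \<noteq> a'" by (meson card_2_iff)
    \<comment> \<open>two classes share at most one touched edge, and neither shares one with \<open>b\<close>\<close>
    have "card (X a \<inter> X a') \<le> Suc 0"
    proof (subst card_le_Suc0_iff_eq)
      show "\<forall>e\<in>X a \<inter> X a'. \<forall>f\<in>X a \<inter> X a'. e = f"
      proof (intro ballI)
        fix e f assume ef: "e \<in> X a \<inter> X a'" "f \<in> X a \<inter> X a'"
        obtain x y where x: "e = {x, y}" "x \<in> C" "y \<in> C" "c x = a" "c y = a'" "e \<in> E"
          using touch_both[of e C c a a'] ef a unfolding X_def by blast
        obtain u v where u: "f = {u, v}" "u \<in> C" "v \<in> C" "c u = a" "c v = a'" "f \<in> E"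
          using touch_both[of f C c a a'] ef a unfolding X_def by blast
        show "e = f" by (rule good_distinct[OF g]) (use x u in auto)
      qed
    qed (use fin in auto)
    moreover have "card (X a) + card (X a') = card (X a \<union> X a') + card (X a \<inter> X a')"
      using card_Un_Int fin by blast
    moreover have "card (X a \<union> X a' \<union> X b \<union> H) \<le> card E"
      using finite_E by (intro card_mono) (auto simp: X_def touch_def H_def)
    moreover have "card (X a \<union> X a' \<union> X b \<union> H) = card (X a \<union> X a') + card (X b) + card H"
    proof -
      have "(X a \<union> X a') \<inter> X b = {}" using a by (auto simp: Q_def)
      then show ?thesis using HX[of a] HX[of a'] HX[of b] fin
        by (subst card_Un_disjoint; auto simp: card_Un_disjoint)
    qed
    ultimately show False
      using full[of a] full[of a'] a kUQ 3 U split_b r few_edges dH by simp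
  next
    case 4
    \<comment> \<open>\<open>d = k - 1\<close>: every color is in use, but only \<open>k - 1\<close> edges can be touched\<close>
    have "0 < card (X a)" if "a \<in> A" for a
    proof -
      consider "a = b" | "a \<in> U" | "a \<in> Q" using \<open>A = insert b (U \<union> Q)\<close> \<open>a \<in> A\<close> by blast
      then show ?thesis
        using split_b r Upos[of a] full[of a] dk by cases auto
    qed
    then have "k \<le> card {u \<in> C. 0 < degree E u}"
      using loaded_colors[OF CV, of c] by (simp add: X_def)
    moreover have "2 \<le> d" using 4 kUQ by simp
    ultimately have "k \<le> card T" using gr by (simp add: growing_def d_def T_def)
    then show False using Tm few_edges dH 4 by simp
  next
    case 6
    \<comment> \<open>\<open>d \<le> k - 3\<close>: the sum of all loads is too large\<close>
    then obtain x where x: "k = d + x + 3" using that[of "k - d - 3"] by simp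
    obtain q where q: "card Q = q + 3" using 6 that[of "card Q - 3"] by simp
    have "card Q * (k - d) = q * x + q + 3 * x + 3 + 2 * card Q"
      using x q by (simp add: algebra_simps)
    then have "3 * x + 3 + 2 * card Q \<le> (\<Sum>a\<in>Q. card (X a))" using SQ by linarith
    then show False using S SU U split_b r rF Tm TF few_edges dH kUQ x by linarith
  next
    case 5
    \<comment> \<open>\<open>d = k - 2\<close>: the sum of loads is tight.  So only one edge leaves the colored part, and a
    color joined to \<open>b\<close> has no other touched edge.  Then \<open>p\<close> and its colored neighbors
    form a component of the colored part, and it contains every colored vertex with an edge
    since the colored part is open-ended.  But a color in \<open>Q\<close> is used outside of it.\<close>
    then have "2 \<le> d" using kUQ by linarith
    then have oe: "open_ended C" using gr by (simp add: growing_def d_def)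
    have "k - d = 2" using 5 kUQ by linarith
    then have Q2: "2 * card Q \<le> (\<Sum>a\<in>Q. card (X a))" using SQ by simp
    have eqs: "card F = 1" "(\<Sum>a\<in>U. card (X a)) = card U"
      using Q2 S SU U split_b r rF Tm TF few_edges dH kUQ 5 by linarith+
    have U1: "card (X a) = 1" if "a \<in> U" for a
    proof (rule ccontr)
      assume "card (X a) \<noteq> 1"
      have "(\<Sum>a\<in>U. 1) < (\<Sum>a\<in>U. card (X a))"
      proof (rule sum_strict_mono_ex1)
        have "1 < card (X a)" using Upos[OF that] \<open>card (X a) \<noteq> 1\<close> by simp
        then show "\<exists>a\<in>U. 1 < card (X a)" using that by blast
      qed (use Upos fin in auto)
      then show False using eqs by simp
    qed
    have F0: "F = {{w, p}}"
    proof -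
      have "{w, p} \<in> F" using e0 XT[of b] by (auto simp: F_def)
      then show ?thesis using eqs(1) by (metis card_1_singletonE singletonD)
    qed
    obtain a where a: "a \<in> Q" using 5 by fastforce
    then have "0 < card (X a)" using full dk by fastforce
    then obtain e where "e \<in> X a" by (metis card_gt_0_iff ex_in_conv)
    then obtain y where y: "y \<in> C" "c y = a" "0 < degree E y"
      using finite_E by (auto simp: X_def touch_def degree_def card_gt_0_iff)
    then obtain x z where x: "x \<in> C" "(y, x) \<in> conn (inner E C)" "z \<in> V - C" "{x, z} \<in> E"
      using oe by (auto simp: open_ended_def)
    then have "{x, z} \<in> F" by (auto simp: F_def T_def inner_def)
    then have "x = p" using F0 x wC by (auto simp: doubleton_eq_iff)
    then have "(p, y) \<in> conn (inner E C)" using x conn_sym by metis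
    then have "y \<in> insert p {u \<in> C. {p, u} \<in> E}"
    proof (rule conn_closed)
      fix s t assume s: "s \<in> insert p {u \<in> C. {p, u} \<in> E}" "{s, t} \<in> inner E C"
      show "t \<in> insert p {u \<in> C. {p, u} \<in> E}"
      proof (cases "s = p")
        case True
        then show ?thesis using s by (auto simp: inner_def)
      next
        case False
        then have ps: "s \<in> C" "{p, s} \<in> E" using s by auto
        then have "c p \<noteq> c s" using good_proper[OF g p(1)] by blast
        moreover have "{p, s} \<in> X b \<inter> X (c s)" using ps p by (auto simp: X_def touch_def b_def)
        moreover have "c s \<in> A" using g ps by (auto simp: good_def)
        ultimately have "c s \<in> U" by (auto simp: U_def b_def)
        then have "card (X (c s)) = 1" by (rule U1)
        moreover have "{p, s} \<in> X (c s)" "{s, t} \<in> X (c s)"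
          using ps s by (auto simp: X_def touch_def inner_def)
        ultimately have "{p, s} = {s, t}" by (auto simp: card_1_singleton_iff)
        then show ?thesis by (auto simp: doubleton_eq_iff)
      qed
    qed simp
    moreover have "y \<noteq> p" using y a by (auto simp: Q_def b_def)
    ultimately have "{p, y} \<in> X b \<inter> X a"
      using p y by (auto simp: X_def touch_def b_def)
    then show False using a by (auto simp: Q_def)
  qed
qed

text \<open>Any fitting color keeps the partial coloring good; this is what makes the choice made by
  the program irrelevant.\<close>

definition step :: "'a set \<Rightarrow> ('a \<Rightarrow> nat) \<Rightarrow> 'a \<Rightarrow> bool" where
  "step C c w \<longleftrightarrow> (\<exists>a. fits C c w a) \<and> (\<forall>a. fits C c w a \<longrightarrow> good (insert w C) (c(w := a)))"

lemma leaf_neighbor: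
  assumes "degree E w \<le> 1" "{w, p} \<in> E" "{w, q} \<in> E"
  shows "p = q"
proof -
  have "card {e \<in> E. w \<in> e} \<le> Suc 0" using assms by (simp add: degree_def)
  then have "\<forall>e\<in>{e \<in> E. w \<in> e}. \<forall>f\<in>{e \<in> E. w \<in> e}. e = f"
    using finite_E by (subst (asm) card_le_Suc0_iff_eq) auto
  moreover have "{w, p} \<in> {e \<in> E. w \<in> e}" "{w, q} \<in> {e \<in> E. w \<in> e}" using assms by auto
  ultimately have "{w, p} = {w, q}" by (meson bspec)
  then show ?thesis by (auto simp: doubleton_eq_iff)
qed

lemma leaf_step:
  assumes g: "good C c" and w: "w \<in> V - C" "degree E w \<le> 1"
  shows "step C c w"
proof -
  have one: "one_linked C w"
    unfolding one_linked_def
  proof (intro ballI impI)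
    fix p q assume "p \<in> C" "q \<in> C" "{w, p} \<in> E" "{w, q} \<in> E"
    then show "p = q" using leaf_neighbor w(2) by metis
  qed
  have "\<exists>a. fits C c w a"
  proof (cases "\<exists>p\<in>C. {w, p} \<in> E")
    case True
    then obtain p where "p \<in> C" "{w, p} \<in> E" by blast
    then show ?thesis by (rule fit_linked[OF g w(1) _ _ one]) (use w(2) in simp)
  next
    case False
    then show ?thesis by (rule fit_unlinked[OF g w(1)]) (use w(2) in simp)
  qed
  then show ?thesis unfolding step_def using good_insert[OF g w(1) one] by blast
qed

text \<open>If no uncolored vertex of degree at least two has a colored neighbor, then the colored set
  together with the leaves hanging off it is closed under adjacency.  Hence \<open>w\<close> lies in an
  untouched component and convexity survives.\<close>

lemma branch_step:
  assumes g: "good C c" and gr: "growing C" and w: "w \<in> V - C" "2 \<le> degree E w"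
    and next_w: "(\<exists>p\<in>C. {w, p} \<in> E) \<or>
      \<not> (\<exists>u\<in>V - C. 2 \<le> degree E u \<and> (\<exists>p\<in>C. {u, p} \<in> E))"
  shows "step C c w \<and> growing (insert w C)"
proof -
  have CV: "C \<subseteq> V" using g by (simp add: good_def)
  have cv: "convex E C" using gr by (simp add: growing_def)
  have one: "one_linked C w"
    unfolding one_linked_def
  proof (intro ballI impI)
    fix p q assume "p \<in> C" "q \<in> C" "{w, p} \<in> E" "{w, q} \<in> E"
    then show "p = q" using one_link[OF forest cv, of w p q] w by simp
  qed
  have "\<exists>a. fits C c w a"
  proof (cases "\<exists>p\<in>C. {w, p} \<in> E")
    case True
    then obtain p where "p \<in> C" "{w, p} \<in> E" by blast
    then show ?thesis by (rule fit_linked[OF g w(1) _ _ one gr])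
  next
    case False
    then show ?thesis by (rule fit_unlinked[OF g w(1) _ gr])
  qed
  moreover have "(\<exists>p\<in>C. {w, p} \<in> E) \<or> (\<forall>p\<in>C. (p, w) \<notin> conn E)"
  proof (rule disjCI, rule ccontr)
    assume "\<not> (\<forall>p\<in>C. (p, w) \<notin> conn E)" and "\<not> (\<exists>p\<in>C. {w, p} \<in> E)"
    then obtain p where p: "p \<in> C" "(p, w) \<in> conn E"
      and stuck: "\<And>u q. u \<in> V - C \<Longrightarrow> 2 \<le> degree E u \<Longrightarrow> q \<in> C \<Longrightarrow> {u, q} \<notin> E"
      using next_w by blast
    have "w \<in> C \<union> {u \<in> V. degree E u \<le> 1 \<and> (\<exists>q\<in>C. {u, q} \<in> E)}"
      using p(2)
    proof (rule conn_closed)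
      fix s t assume s: "s \<in> C \<union> {u \<in> V. degree E u \<le> 1 \<and> (\<exists>q\<in>C. {u, q} \<in> E)}" "{s, t} \<in> E"
      have t: "t \<in> V" using s simple by (auto simp: simple_graph_def)
      show "t \<in> C \<union> {u \<in> V. degree E u \<le> 1 \<and> (\<exists>q\<in>C. {u, q} \<in> E)}"
      proof (cases "s \<in> C")
        case True
        moreover have "t \<in> C \<or> degree E t \<le> 1"
          using stuck[of t s] True t s(2) by (cases "t \<in> C"; cases "2 \<le> degree E t") (auto simp: insert_commute)
        ultimately show ?thesis using t s(2) by (auto simp: insert_commute)
      next
        case False
        then obtain q where q: "q \<in> C" "{s, q} \<in> E" "degree E s \<le> 1" using s by auto
        then have "q = t" using leaf_neighbor s(2) by metis
        then show ?thesis using q by simp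
      qed
    qed (use p in simp)
    then show False using w by auto
  qed
  ultimately show ?thesis
    unfolding step_def using good_insert[OF g w(1) one] growing_insert[OF gr w CV] by blast
qed

text \<open>Color the vertices of degree at least two first.  For the remaining ones the order does not
  matter, since a leaf cannot have two colored neighbors.\<close>

lemma good_extension:
  assumes "good C c" "growing C"
  shows "\<exists>c'. good V c' \<and> (\<forall>u\<in>C. c' u = c u)"
proof -
  have leaves: "\<exists>c'. good V c' \<and> (\<forall>u\<in>C. c' u = c u)"
    if "good C c" "\<forall>u\<in>V - C. degree E u \<le> 1" for C c
    using that
  proof (induction "card (V - C)" arbitrary: C c)
    case 0
    then have "C = V" using finite_V by (auto simp: good_def)
    then show ?case using 0 by blast
  next
    case (Suc m)
    have "V - C \<noteq> {}" using Suc(2) by (metis card.empty nat.distinct(1))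
    then obtain w where w: "w \<in> V - C" by blast
    have "step C c w" using leaf_step[OF Suc.prems(1) w] Suc.prems(2) w by blast
    then obtain a where "good (insert w C) (c(w := a))" by (auto simp: step_def)
    moreover have "m = card (V - insert w C)"
      using Suc(2) w finite_V by (metis Diff_insert card_Diff_singleton diff_Suc_1)
    ultimately obtain c' where "good V c'" "\<forall>u\<in>insert w C. c' u = (c(w := a)) u"
      using Suc.hyps(1)[of "insert w C" "c(w := a)"] Suc.prems(2) by blast
    then show ?case using w by (intro exI[of _ c']) auto
  qed
  show ?thesis
    using assms
  proof (induction "card {u \<in> V - C. 2 \<le> degree E u}" arbitrary: C c)
    case 0
    then have "\<forall>u\<in>V - C. degree E u \<le> 1" using finite_V by force
    then show ?case using leaves 0 by blast
  next
    case (Suc m)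
    let ?B = "{u \<in> V - C. 2 \<le> degree E u}"
    have "?B \<noteq> {}" using Suc(2) by (metis card.empty nat.distinct(1))
    then obtain w where w: "w \<in> V - C" "2 \<le> degree E w"
      "(\<exists>p\<in>C. {w, p} \<in> E) \<or> \<not> (\<exists>u\<in>V - C. 2 \<le> degree E u \<and> (\<exists>p\<in>C. {u, p} \<in> E))"
      by blast
    then have "step C c w" "growing (insert w C)"
      using branch_step[OF Suc.prems w] by auto
    then obtain a where a: "good (insert w C) (c(w := a))" by (auto simp: step_def)
    have "{u \<in> V - insert w C. 2 \<le> degree E u} = ?B - {w}" by auto
    then have "m = card {u \<in> V - insert w C. 2 \<le> degree E u}"
      using Suc(2) w finite_V by simp
    then obtain c' where "good V c'" "\<forall>u\<in>insert w C. c' u = (c(w := a)) u"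
      using Suc.hyps(1)[of "insert w C" "c(w := a)"] a \<open>growing (insert w C)\<close> by blast
    then show ?case using w by (intro exI[of _ c']) auto
  qed
qed

text \<open>Pairwise unconnected vertices with different colors: there are no colored edges yet, so each
  load is a single degree, and every edge at a colored vertex leaves the colored part.\<close>

lemma good_start:
  assumes C: "C \<subseteq> V" "inj_on c C" "c ` C \<subseteq> A"
    and apart: "\<And>x y. x \<in> C \<Longrightarrow> y \<in> C \<Longrightarrow> (x, y) \<in> conn E \<Longrightarrow> x = y"
  shows "good C c \<and> growing C"
proof -
  have far: "x = y" if "{x, y} \<in> E" "x \<in> C" "y \<in> C" for x y
    using apart conn_edge that by metis
  have noloop: "{x, y} \<in> E \<Longrightarrow> x \<noteq> y" for x y using simple by (auto simp: simple_graph_def)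
  have inner: "inner E C = {}"
  proof (rule equals0I)
    fix e assume "e \<in> inner E C"
    then have "e \<in> E" "e \<subseteq> C" by (auto simp: inner_def)
    then show False using simple_graph_edge[OF simple \<open>e \<in> E\<close>] far by (metis insert_subset)
  qed
  have load: "card (touch E C c a) < k" for a
  proof (cases "a \<in> c ` C")
    case True
    then obtain u where u: "u \<in> C" "a = c u" by blast
    then have "touch E C c a = {e \<in> E. u \<in> e}" using C by (auto simp: touch_def inj_on_def)
    then show ?thesis using degree_less[of u] u C by (auto simp: degree_def)
  next
    case False
    then have "touch E C c a = {}" by (auto simp: touch_def)
    then show ?thesis using few_edges by simp
  qed
  have "good C c" using C inner load by (simp add: good_def harmonious_coloring_def)
  moreover have "convex E C"
    unfolding convex_def by (intro ballI impI) (metis apart conn_refl)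
  moreover have "open_ended C"
    unfolding open_ended_def
  proof (intro ballI impI)
    fix y assume y: "y \<in> C" "0 < degree E y"
    then obtain z where z: "{y, z} \<in> E" "z \<in> V" "z \<noteq> y" using degree_pos_edge[OF simple] by metis
    then have "z \<notin> C" using far y by metis
    then show "\<exists>x\<in>C. (y, x) \<in> conn (inner E C) \<and> (\<exists>z\<in>V - C. {x, z} \<in> E)"
      using y z by (intro bexI[of _ y]) auto
  qed
  moreover have "card {u \<in> C. 0 < degree E u} \<le> card {e \<in> E. e \<inter> C \<noteq> {}}"
  proof -
    have "\<exists>f. \<forall>u\<in>{u \<in> C. 0 < degree E u}. u \<in> f u \<and> f u \<in> E"
      by (rule bchoice) (metis (mono_tags, lifting) degree_pos_edge[OF simple] insertCI mem_Collect_eq)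
    then obtain f where f: "\<And>u. u \<in> C \<Longrightarrow> 0 < degree E u \<Longrightarrow> u \<in> f u \<and> f u \<in> E" by blast
    have "inj_on f {u \<in> C. 0 < degree E u}"
    proof (rule inj_onI)
      fix x y assume xy: "x \<in> {u \<in> C. 0 < degree E u}" "y \<in> {u \<in> C. 0 < degree E u}" "f x = f y"
      then have e: "x \<in> f x" "y \<in> f x" "f x \<in> E" using f[of x] f[of y] by auto
      then obtain z where "f x = {x, z}" using simple_graph_edge_at[OF simple] by metis
      then have "y = x \<or> {x, y} \<in> E" using e by auto
      then show "x = y" using far xy by auto
    qed
    moreover have "f ` {u \<in> C. 0 < degree E u} \<subseteq> {e \<in> E. e \<inter> C \<noteq> {}}" using f by blast
    ultimately show ?thesis using finite_E by (intro card_inj_on_le[of f]) auto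
  qed
  ultimately show ?thesis by (simp add: growing_def)
qed

end

section \<open>Removing a vertex of maximum degree\<close>

text \<open>The number \<open>k\<close> of colors besides that of \<open>v\<close> is chosen such that all degrees are below \<open>k\<close>
  once \<open>v\<close> is deleted.\<close>

locale big_star =
  fixes V :: "'a set" and E :: "'a set set" and v :: 'a and k :: nat
  assumes forest_VE: "forest V E" and v: "v \<in> V"
    and max: "u \<in> V \<Longrightarrow> degree E u \<le> degree E v"
    and big: "card V + 2 \<le> 3 * degree E v"
    and k: "k = degree E v \<and> (\<forall>u\<in>V. u \<noteq> v \<longrightarrow> {v, u} \<notin> E \<longrightarrow> degree E u < degree E v) \<or>
      k = Suc (degree E v)"
begin

definition rest :: "'a set set" where "rest = {e \<in> E. v \<notin> e}"

definition nbrs :: "'a set" where "nbrs = {u. {v, u} \<in> E}"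

lemma simple_VE: "simple_graph V E" and finite_VE: "finite V" "finite E"
  using forest_VE simple_graph_finite_edges by (auto simp: forest_def simple_graph_def)

lemma no_loop: "{x, x} \<notin> E"
  using simple_VE by (auto simp: simple_graph_def)

lemma nbrs_subset: "nbrs \<subseteq> V - {v}"
  using simple_VE no_loop by (auto simp: nbrs_def simple_graph_def)

lemma star_edges: "{e \<in> E. v \<in> e} = (\<lambda>u. {v, u}) ` nbrs"
proof (rule set_eqI, rule iffI)
  fix e assume e: "e \<in> {e \<in> E. v \<in> e}"
  then obtain u where "e = {v, u}" using simple_graph_edge_at[OF simple_VE, of e v] by (metis (no_types, lifting) mem_Collect_eq)
  then show "e \<in> (\<lambda>u. {v, u}) ` nbrs" using e by (auto simp: nbrs_def)
qed (auto simp: nbrs_def)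

lemma card_nbrs: "card nbrs = degree E v"
  unfolding degree_def star_edges by (subst card_image) (auto simp: inj_on_def doubleton_eq_iff)

lemma degree_rest:
  assumes "u \<noteq> v"
  shows "degree E u = degree rest u + (if u \<in> nbrs then 1 else 0)"
proof -
  have eq: "{e \<in> E. u \<in> e} = {e \<in> rest. u \<in> e} \<union> {e \<in> E. v \<in> e \<and> u \<in> e}"
    by (auto simp: rest_def)
  have "{e \<in> E. v \<in> e \<and> u \<in> e} = (if u \<in> nbrs then {{v, u}} else {})"
  proof (rule set_eqI, rule iffI)
    fix e assume e: "e \<in> {e \<in> E. v \<in> e \<and> u \<in> e}"
    then obtain x where "e = {v, x}" using simple_graph_edge_at[OF simple_VE, of e v] by (metis (no_types, lifting) mem_Collect_eq)
    then show "e \<in> (if u \<in> nbrs then {{v, u}} else {})" using e assms by (auto simp: nbrs_def)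
  qed (auto simp: nbrs_def split: if_splits)
  moreover have "card {e \<in> E. u \<in> e} = card {e \<in> rest. u \<in> e} + card {e \<in> E. v \<in> e \<and> u \<in> e}"
    unfolding eq using finite_VE by (subst card_Un_disjoint) (auto simp: rest_def)
  ultimately show ?thesis by (simp add: degree_def)
qed

text \<open>A forest has fewer edges than vertices, so at most \<open>3 \<Delta> - 3\<close>, and \<open>\<Delta>\<close> of them are
  at \<open>v\<close>.\<close>

sublocale palette "V - {v}" rest "{1..k}" k
proof
  show "forest (V - {v}) rest"
    using forest_VE by (auto simp: forest_def simple_graph_def rest_def is_cycle_def)
  have rest_eq: "rest = E - {e \<in> E. v \<in> e}" by (auto simp: rest_def)
  have "card rest = card E - degree E v"
    unfolding degree_def rest_eq using finite_VE by (intro card_Diff_subset) auto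
  moreover have "card E < card V" using card_edges_forest[OF forest_VE] v by blast
  moreover have "degree E v \<le> card E"
    unfolding degree_def using finite_VE by (intro card_mono) auto
  moreover have "degree E v \<le> k" using k by auto
  ultimately show "card rest + 3 \<le> 2 * k" using big by linarith
  show "degree rest u < k" if "u \<in> V - {v}" for u
  proof (cases "u \<in> nbrs")
    case True
    then show ?thesis using degree_rest[of u] max[of u] that k by auto
  next
    case False
    then show ?thesis using degree_rest[of u] max[of u] that k by (auto simp: nbrs_def)
  qed
qed auto

text \<open>Two connected neighbors of \<open>v\<close> in the rest of the forest would yield a cycle through \<open>v\<close>.\<close>

lemma good_nbrs:
  assumes "inj_on c nbrs" "c ` nbrs \<subseteq> {1..k}"
  shows "good nbrs c \<and> growing nbrs"
proof (rule good_start[OF nbrs_subset assms])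
  fix x y assume "x \<in> nbrs" "y \<in> nbrs" "(x, y) \<in> conn rest"
  then show "x = y"
    by (intro forest_detour[OF forest_VE, of rest v x y]) (simp_all add: nbrs_def rest_def)
qed

text \<open>The color \<open>0\<close> occurs only at \<open>v\<close>, so a pair containing it belongs to an edge at \<open>v\<close> and is
  determined by the color of the neighbor.\<close>

lemma harmonious_if_rest_good:
  assumes g: "good (V - {v}) c" and inj: "inj_on c nbrs" and cv: "c v = 0"
  shows "harmonious_coloring V E c \<and> c ` V \<subseteq> {..k}"
proof -
  have pos: "1 \<le> c u" "c u \<le> k" if "u \<in> V" "u \<noteq> v" for u
    using g that unfolding good_def by auto
  have proper: "c x \<noteq> c y" if xy: "x \<in> V" "y \<in> V" "{x, y} \<in> E" for x y
  proof -
    have "x \<noteq> y" using xy no_loop by auto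
    then consider "x = v" "y \<noteq> v" | "y = v" "x \<noteq> v" | "x \<noteq> v" "y \<noteq> v" by blast
    then show ?thesis
    proof cases
      case 3
      then show ?thesis using good_proper[OF g, of x y] xy by (auto simp: rest_def)
    qed (use pos[of x] pos[of y] cv xy in auto)
  qed
  have zero: "0 \<in> c ` e \<longleftrightarrow> v \<in> e" if "e \<in> E" for e
  proof -
    have "e \<subseteq> V" using simple_VE that by (auto simp: simple_graph_def)
    then show ?thesis using pos cv by force
  qed
  have distinct: "e = f" if ef: "e \<in> E" "f \<in> E" "c ` e = c ` f" for e f
  proof (cases "v \<in> e")
    case True
    then have "v \<in> f" using zero ef by metis
    then have "e \<in> (\<lambda>u. {v, u}) ` nbrs" "f \<in> (\<lambda>u. {v, u}) ` nbrs"
      using True ef unfolding star_edges[symmetric] by simp_all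
    then obtain x y where xy: "e = {v, x}" "f = {v, y}" "x \<in> nbrs" "y \<in> nbrs"
      by (elim imageE)
    then have "{0, c x} = {0, c y}" using ef(3) cv by simp
    then have "c x = c y" by (auto simp: doubleton_eq_iff)
    then show ?thesis using xy inj by (auto simp: inj_on_def)
  next
    case False
    then have "v \<notin> f" using zero ef by metis
    then have "e \<in> rest" "f \<in> rest" using False ef by (auto simp: rest_def)
    moreover then have "e \<subseteq> V - {v}" "f \<subseteq> V - {v}" using simple by (auto simp: simple_graph_def)
    ultimately show ?thesis using good_distinct[OF g] ef(3) by blast
  qed
  have "c ` V \<subseteq> {..k}" using pos cv by force
  moreover have "harmonious_coloring V E c"
    unfolding harmonious_coloring_def using proper distinct by blast
  ultimately show ?thesis by simp
qed

lemma ex_coloring: "\<exists>c. harmonious_coloring V E c \<and> c ` V \<subseteq> {..k}"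
proof -
  have fin: "finite nbrs" using nbrs_subset finite_VE finite_subset by blast
  have "card nbrs \<le> card {1..k}" using card_nbrs k by auto
  then obtain c where c: "c ` nbrs \<subseteq> {1..k}" "inj_on c nbrs"
    using card_le_inj[OF fin, of "{1..k}"] by auto
  then obtain c' where c': "good (V - {v}) c'" "\<forall>u\<in>nbrs. c' u = c u"
    using good_extension[of nbrs c] good_nbrs by blast
  let ?c = "c'(v := 0)"
  have same: "?c u = c' u" if "u \<in> V - {v}" for u using that by simp
  have "good (V - {v}) ?c"
  proof -
    have im: "?c ` e = c' ` e" if "e \<subseteq> V - {v}" for e using that by (auto simp: image_iff)
    have "touch rest (V - {v}) ?c a = touch rest (V - {v}) c' a" for a
      unfolding touch_def by auto
    moreover have "harmonious_coloring (V - {v}) (inner rest (V - {v})) ?c"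
      using c'(1) im unfolding good_def harmonious_coloring_def inner_def by auto
    ultimately show ?thesis using c'(1) im[of "V - {v}"] unfolding good_def by auto
  qed
  moreover have "inj_on ?c nbrs"
    using c(2) c'(2) nbrs_subset by (auto simp: inj_on_def)
  ultimately have "harmonious_coloring V E ?c \<and> ?c ` V \<subseteq> {..k}" by (intro harmonious_if_rest_good) auto
  then show ?thesis by blast
qed

end

section \<open>The harmonious chromatic number\<close>

lemma harmonious_proper:
  "harmonious_coloring V E c \<Longrightarrow> u \<in> V \<Longrightarrow> v \<in> V \<Longrightarrow> {u, v} \<in> E \<Longrightarrow> c u \<noteq> c v"
  by (simp add: harmonious_coloring_def)

lemma harmonious_distinct:
  "harmonious_coloring V E c \<Longrightarrow> e \<in> E \<Longrightarrow> f \<in> E \<Longrightarrow> c ` e = c ` f \<Longrightarrow> e = f"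
  unfolding harmonious_coloring_def by metis

lemma harmonious_closed_star:
  assumes sg: "simple_graph V E" and h: "harmonious_coloring V E c" and v: "v \<in> V"
  shows "inj_on c (insert v {u. {v, u} \<in> E})" and "card (c ` insert v {u. {v, u} \<in> E}) = Suc (degree E v)"
proof -
  let ?N = "{u. {v, u} \<in> E}"
  have NV: "?N \<subseteq> V" and vN: "v \<notin> ?N" using sg by (auto simp: simple_graph_def)
  have "c x = c y \<Longrightarrow> x = y" if xy: "x \<in> ?N" "y \<in> ?N" for x y
  proof (rule ccontr)
    assume eq: "c x = c y" "x \<noteq> y"
    then have "{v, x} = {v, y}" using xy by (intro harmonious_distinct[OF h]) auto
    then show False using eq by (auto simp: doubleton_eq_iff)
  qed
  moreover have "c x \<noteq> c v" if "x \<in> ?N" for x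
    using harmonious_proper[OF h v, of x] that NV by auto
  ultimately show inj: "inj_on c (insert v ?N)" by (simp add: inj_on_def) metis
  have "{e \<in> E. v \<in> e} = (\<lambda>u. {v, u}) ` ?N"
  proof (rule set_eqI, rule iffI)
    fix e assume e: "e \<in> {e \<in> E. v \<in> e}"
    then obtain u where "e = {v, u}" using simple_graph_edge_at[OF sg, of e v] by (metis (no_types, lifting) mem_Collect_eq)
    then show "e \<in> (\<lambda>u. {v, u}) ` ?N" using e by auto
  qed auto
  moreover have "inj_on (\<lambda>u. {v, u}) ?N" by (auto simp: inj_on_def doubleton_eq_iff)
  ultimately have "degree E v = card ?N" by (simp add: degree_def card_image)
  moreover have "finite ?N" using NV sg by (auto simp: simple_graph_def intro: finite_subset)
  ultimately show "card (c ` insert v ?N) = Suc (degree E v)"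
    using inj vN by (simp add: card_image)
qed

lemma harmonious_lower:
  assumes sg: "simple_graph V E" and h: "harmonious_coloring V E c" and v: "v \<in> V"
  shows "Suc (degree E v) \<le> card (c ` V)"
proof -
  have "insert v {u. {v, u} \<in> E} \<subseteq> V" "finite V" using sg v by (auto simp: simple_graph_def)
  then show ?thesis
    using harmonious_closed_star[OF assms] by (metis card_mono finite_imageI image_mono)
qed

text \<open>With only \<open>d + 1\<close> colors, the closed neighborhoods of \<open>u\<close> and \<open>v\<close> both carry all colors.  So if
  \<open>u\<close> and \<open>v\<close> have different colors, each has a neighbor with the color of the other, and
  these two edges carry the same pair.  If they have the same color, then any pair at \<open>u\<close>
  is repeated at \<open>v\<close>.\<close>

lemma harmonious_lower_two:
  assumes sg: "simple_graph V E" and h: "harmonious_coloring V E c" and uv: "u \<in> V" "v \<in> V" "u \<noteq> v"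
    and nonadj: "{u, v} \<notin> E" and deg: "degree E u = d" "degree E v = d" "0 < d"
  shows "Suc (Suc d) \<le> card (c ` V)"
proof (rule ccontr)
  assume few: "\<not> ?thesis"
  have fin: "finite V" using sg by (simp add: simple_graph_def)
  have all: "c ` insert w {x. {w, x} \<in> E} = c ` V" if w: "w \<in> V" "degree E w = d" for w
  proof (rule card_seteq)
    show "c ` insert w {x. {w, x} \<in> E} \<subseteq> c ` V" using w sg by (auto simp: simple_graph_def)
    show "card (c ` V) \<le> card (c ` insert w {x. {w, x} \<in> E})"
      using harmonious_closed_star(2)[OF sg h w(1)] w(2) few by simp
  qed (use fin in simp)
  have EV: "x \<in> V" "y \<in> V" if "{x, y} \<in> E" for x y using sg that by (auto simp: simple_graph_def)
  have proper: "c x \<noteq> c y" if "{x, y} \<in> E" for x y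
    using harmonious_proper[OF h EV[OF that] that] .
  have clash: False if xy: "{u, x} \<in> E" "{v, y} \<in> E" "c ` {u, x} = c ` {v, y}" for x y
  proof -
    have "{u, x} = {v, y}" using harmonious_distinct[OF h xy] .
    then have "u = y" using uv(3) by (auto simp: doubleton_eq_iff)
    then show False using xy(2) nonadj by (simp add: insert_commute)
  qed
  have meet: "\<exists>x. (x = w \<or> {w, x} \<in> E) \<and> c x = a" if "a \<in> c ` V" "w \<in> V" "degree E w = d" for w a
  proof -
    have "a \<in> c ` insert w {x. {w, x} \<in> E}" using all that by simp
    then show ?thesis by auto
  qed
  show False
  proof (cases "c u = c v")
    case True
    obtain x where x: "{u, x} \<in> E" using degree_pos_edge[OF sg, of u] deg by auto
    then obtain y where y: "y = v \<or> {v, y} \<in> E" "c y = c x"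
      using meet[of "c x" v] EV[OF x] uv deg by auto
    then show False using proper[OF x] True clash[OF x, of y] by auto
  next
    case False
    obtain x where x: "{u, x} \<in> E" "c x = c v" using meet[of "c v" u] uv deg False by auto
    obtain y where y: "{v, y} \<in> E" "c y = c u" using meet[of "c u" v] uv deg False by auto
    show False using clash[of x y] x y by auto
  qed
qed

lemma harmonious_number_le:
  fixes c :: "'a \<Rightarrow> nat"
  assumes "harmonious_coloring V E c"
  shows "harmonious_number V E \<le> card (c ` V)"
  unfolding harmonious_number_def using assms by (intro Least_le) blast

lemma harmonious_number_ge:
  assumes "harmonious_coloring V E (c :: 'a \<Rightarrow> nat)"
    and "\<And>c :: 'a \<Rightarrow> nat. harmonious_coloring V E c \<Longrightarrow> m \<le> card (c ` V)"
  shows "m \<le> harmonious_number V E"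
proof -
  let ?P = "\<lambda>k. \<exists>c :: 'a \<Rightarrow> nat. harmonious_coloring V E c \<and> card (c ` V) = k"
  have "?P (card (c ` V))" using assms(1) by blast
  then have "?P (harmonious_number V E)"
    unfolding harmonious_number_def by (rule LeastI[of ?P])
  then obtain c' :: "'a \<Rightarrow> nat" where "harmonious_coloring V E c'" "card (c' ` V) = harmonious_number V E"
    by auto
  then show ?thesis using assms(2)[of c'] by simp
qed

text \<open>The condition that decides between the two values of the harmonious chromatic number.\<close>

definition twin :: "'a set \<Rightarrow> 'a set set \<Rightarrow> bool" where
  "twin V E \<longleftrightarrow> (\<exists>u\<in>V. \<exists>v\<in>V. u \<noteq> v \<and> {u, v} \<notin> E \<and>
     degree E u = max_degree V E \<and> degree E v = max_degree V E)"

lemma degree_le_max: "finite V \<Longrightarrow> u \<in> V \<Longrightarrow> degree E u \<le> max_degree V E"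
  by (simp add: max_degree_def)

lemma max_degree_attained:
  assumes "finite V" "0 < max_degree V E"
  obtains v where "v \<in> V" "degree E v = max_degree V E"
proof -
  have "max_degree V E \<in> insert 0 (degree E ` V)"
    unfolding max_degree_def using assms(1) by (intro Max_in) auto
  then show ?thesis using assms(2) that by auto
qed

text \<open>One less than the harmonious chromatic number: the color of the center is not counted.\<close>

definition palette_size :: "'a set \<Rightarrow> 'a set set \<Rightarrow> nat" where
  "palette_size V E = (if twin V E then Suc (max_degree V E) else max_degree V E)"

lemma big_star_max_degree:
  assumes "forest V E" "card V + 2 \<le> 3 * max_degree V E" "v \<in> V" "degree E v = max_degree V E"
  shows "big_star V E v (palette_size V E)"
proof
  have fin: "finite V" using assms by (auto simp: forest_def simple_graph_def)
  show "degree E u \<le> degree E v" if "u \<in> V" for u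
    using degree_le_max[OF fin that, of E] assms by simp
  show "palette_size V E = degree E v \<and> (\<forall>u\<in>V. u \<noteq> v \<longrightarrow> {v, u} \<notin> E \<longrightarrow> degree E u < degree E v) \<or>
    palette_size V E = Suc (degree E v)"
  proof (cases "twin V E")
    case False
    then have "degree E u \<noteq> degree E v" if "u \<in> V" "u \<noteq> v" "{v, u} \<notin> E" for u
      using that assms unfolding twin_def by metis
    then show ?thesis
      using False assms(4) degree_le_max[OF fin, of _ E] by (force simp: palette_size_def)
  qed (use assms(4) in \<open>simp add: palette_size_def\<close>)
qed (use assms in auto)

theorem harmonious_number_forest:
  assumes f: "forest V E" and big: "card V + 2 \<le> 3 * max_degree V E"
  shows "harmonious_number V E = Suc (palette_size V E)"
proof -
  have sg: "simple_graph V E" and fin: "finite V" using f by (auto simp: forest_def simple_graph_def)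
  have pos: "0 < max_degree V E" using big by simp
  obtain v where vm: "v \<in> V" "degree E v = max_degree V E"
    using max_degree_attained[OF fin pos] .
  interpret big_star V E v "palette_size V E" by (rule big_star_max_degree[OF f big vm])
  obtain c where c: "harmonious_coloring V E c" "c ` V \<subseteq> {..palette_size V E}"
    using ex_coloring by blast
  have "card (c ` V) \<le> Suc (palette_size V E)"
    using card_mono[OF _ c(2)] by simp
  then have "harmonious_number V E \<le> Suc (palette_size V E)"
    using harmonious_number_le[OF c(1)] by simp
  moreover have "Suc (palette_size V E) \<le> card (c' ` V)"
    if h: "harmonious_coloring V E c'" for c' :: "'a \<Rightarrow> nat"
  proof (cases "twin V E")
    case True
    then obtain x y where "x \<in> V" "y \<in> V" "x \<noteq> y" "{x, y} \<notin> E"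
      "degree E x = max_degree V E" "degree E y = max_degree V E" unfolding twin_def by blast
    then show ?thesis
      using harmonious_lower_two[OF sg h] pos True by (simp add: palette_size_def)
  next
    case False
    then show ?thesis using harmonious_lower[OF sg h vm(1)] vm(2) by (simp add: palette_size_def)
  qed
  then have "Suc (palette_size V E) \<le> harmonious_number V E"
    by (rule harmonious_number_ge[OF c(1)])
  ultimately show ?thesis by simp
qed

section \<open>Loop programs: frames, running time and weakest preconditions\<close>

fun writes :: "com \<Rightarrow> string set" where
  "writes Skip = {}"
| "writes (Write x i a) = {x}"
| "writes (Seq p q) = writes p \<union> writes q"
| "writes (Cond b p q) = writes p \<union> writes q"
| "writes (While b p) = writes p"

lemma exec_frame: "exec p s t s' \<Longrightarrow> x \<notin> writes p \<Longrightarrow> s' x = s x"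
  by (induction rule: exec.induct) auto

text \<open>Termination within polynomial time from every state, regardless of what the program
  computes.  The successor avoids a special case for \<open>n = 0\<close> in the closure lemmas.\<close>

definition poly_time :: "com \<Rightarrow> bool" where
  "poly_time p \<longleftrightarrow> (\<exists>c d. \<forall>s. \<exists>t s'. exec p s t s' \<and> t \<le> c * Suc (s ''n'' 0) ^ d)"

text \<open>The bound is always the number of vertices; loops over colors are cut off by a test in the
  body.\<close>

definition For :: "string \<Rightarrow> com \<Rightarrow> com" where
  "For i p = Seq (Write i (Num 0) (Num 0))
     (While (Less (Read i (Num 0)) (Read ''n'' (Num 0)))
       (Seq p (Write i (Num 0) (Plus (Read i (Num 0)) (Num 1)))))"

lemma writes_For [simp]: "writes (For i p) = insert i (writes p)"
  by (auto simp: For_def)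

lemma poly_time_Skip: "poly_time Skip"
  unfolding poly_time_def
  by (intro exI[of _ 1] exI[of _ 0] allI, intro exI conjI, rule exec.Skip) simp

lemma poly_time_Write: "poly_time (Write x i a)"
  unfolding poly_time_def
  by (intro exI[of _ 1] exI[of _ 0] allI, intro exI conjI, rule exec.Write) simp

lemma poly_time_two:
  assumes "poly_time p" "poly_time q"
  obtains c d where "\<And>s. \<exists>t s'. exec p s t s' \<and> t \<le> c * Suc (s ''n'' 0) ^ d"
    "\<And>s. \<exists>t s'. exec q s t s' \<and> t \<le> c * Suc (s ''n'' 0) ^ d"
proof -
  have weaken: "a * Suc n ^ b \<le> c * Suc n ^ d" if "a \<le> c" "b \<le> d" for a b c d n :: nat
    using that by (intro mult_le_mono power_increasing) auto
  obtain c d where p: "\<And>s. \<exists>t s'. exec p s t s' \<and> t \<le> c * Suc (s ''n'' 0) ^ d"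
    using assms(1) unfolding poly_time_def by blast
  obtain c' d' where q: "\<And>s. \<exists>t s'. exec q s t s' \<and> t \<le> c' * Suc (s ''n'' 0) ^ d'"
    using assms(2) unfolding poly_time_def by blast
  have "\<exists>t s'. exec p s t s' \<and> t \<le> max c c' * Suc (s ''n'' 0) ^ max d d'" for s
    using p[of s] weaken[of c "max c c'" d "max d d'"] by (meson le_trans max.cobounded1)
  moreover have "\<exists>t s'. exec q s t s' \<and> t \<le> max c c' * Suc (s ''n'' 0) ^ max d d'" for s
    using q[of s] weaken[of c' "max c c'" d' "max d d'"] by (meson le_trans max.cobounded2)
  ultimately show ?thesis using that by blast
qed

lemma poly_time_Seq:
  assumes "poly_time p" "poly_time q" "''n'' \<notin> writes p"
  shows "poly_time (Seq p q)"
proof -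
  obtain c d where p: "\<And>s. \<exists>t s'. exec p s t s' \<and> t \<le> c * Suc (s ''n'' 0) ^ d"
    and q: "\<And>s. \<exists>t s'. exec q s t s' \<and> t \<le> c * Suc (s ''n'' 0) ^ d"
    using poly_time_two[OF assms(1,2)] by metis
  have "\<exists>t s'. exec (Seq p q) s t s' \<and> t \<le> (2 * c) * Suc (s ''n'' 0) ^ d" for s
  proof -
    obtain t s' where s': "exec p s t s'" "t \<le> c * Suc (s ''n'' 0) ^ d" using p by blast
    obtain t' s'' where s'': "exec q s' t' s''" "t' \<le> c * Suc (s' ''n'' 0) ^ d" using q by blast
    have "exec (Seq p q) s (t + t') s''" using s'(1) s''(1) by (rule exec.Seq)
    moreover have "t + t' \<le> (2 * c) * Suc (s ''n'' 0) ^ d"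
      using s' s'' exec_frame[OF s'(1) assms(3)] by simp
    ultimately show ?thesis by blast
  qed
  then show ?thesis unfolding poly_time_def by blast
qed

lemma poly_time_Cond:
  assumes "poly_time p" "poly_time q"
  shows "poly_time (Cond b p q)"
proof -
  obtain c d where p: "\<And>s. \<exists>t s'. exec p s t s' \<and> t \<le> c * Suc (s ''n'' 0) ^ d"
    and q: "\<And>s. \<exists>t s'. exec q s t s' \<and> t \<le> c * Suc (s ''n'' 0) ^ d"
    using poly_time_two[OF assms(1,2)] by metis
  have "\<exists>t s'. exec (Cond b p q) s t s' \<and> t \<le> Suc c * Suc (s ''n'' 0) ^ d" for s
  proof -
    obtain t s' where t: "exec (Cond b p q) s (t + 1) s'" "t \<le> c * Suc (s ''n'' 0) ^ d"
      using p[of s] q[of s] exec.CondTrue[of b s p _ _ q] exec.CondFalse[of b s q _ _ p] by metis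
    have "1 \<le> Suc (s ''n'' 0) ^ d" by (rule one_le_power) simp
    then have "t + 1 \<le> c * Suc (s ''n'' 0) ^ d + Suc (s ''n'' 0) ^ d" by (rule add_le_mono[OF t(2)])
    then show ?thesis using t(1) by (intro exI[of _ "t + 1"] exI[of _ s']) simp
  qed
  then show ?thesis unfolding poly_time_def by blast
qed

text \<open>The body leaves the counter and \<open>n\<close> alone, so it is executed exactly \<open>n\<close> times.\<close>

lemma poly_time_For:
  assumes "poly_time p" "''n'' \<notin> writes p" "i \<notin> writes p" "i \<noteq> ''n''"
  shows "poly_time (For i p)"
proof -
  obtain c d where p: "\<And>s. \<exists>t s'. exec p s t s' \<and> t \<le> c * Suc (s ''n'' 0) ^ d"
    using assms(1) unfolding poly_time_def by blast
  let ?b = "Less (Read i (Num 0)) (Read ''n'' (Num 0))"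
  let ?inc = "Write i (Num 0) (Plus (Read i (Num 0)) (Num 1))"
  have loop: "\<exists>t s'. exec (While ?b (Seq p ?inc)) s t s' \<and>
      t \<le> m * (c * Suc (s ''n'' 0) ^ d + 2) + 1"
    if "m = s ''n'' 0 - s i 0" for m s
    using that
  proof (induction m arbitrary: s)
    case 0
    then have "\<not> bval ?b s" by simp
    then have "exec (While ?b (Seq p ?inc)) s 1 s" by (rule exec.WhileFalse)
    then show ?case by auto
  next
    case (Suc m)
    obtain t s' where s': "exec p s t s'" "t \<le> c * Suc (s ''n'' 0) ^ d" using p by blast
    have n: "s' ''n'' 0 = s ''n'' 0" "s' i 0 = s i 0"
      using exec_frame[OF s'(1)] assms by simp_all
    let ?s = "s'(i := (s' i)(0 := s' i 0 + 1))"
    have "exec ?inc s' 1 ?s" using exec.Write[of i "Num 0" "Plus (Read i (Num 0)) (Num 1)" s'] by simp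
    then have one: "exec (Seq p ?inc) s (t + 1) ?s" using s'(1) exec.Seq by blast
    have sn: "?s ''n'' 0 = s ''n'' 0" and m: "m = ?s ''n'' 0 - ?s i 0" using Suc.prems n assms(4) by auto
    obtain t' s'' where s'': "exec (While ?b (Seq p ?inc)) ?s t' s''"
      "t' \<le> m * (c * Suc (s ''n'' 0) ^ d + 2) + 1" using Suc.IH[of ?s] m unfolding sn by blast
    have "bval ?b s" using Suc.prems by simp
    then have "exec (While ?b (Seq p ?inc)) s (t + 1 + t' + 1) s''"
      using one s''(1) by (rule exec.WhileTrue)
    then show ?case using s'(2) s''(2) by (intro exI[of _ "t + 1 + t' + 1"] exI[of _ s'']) simp
  qed
  have "\<exists>t s'. exec (For i p) s t s' \<and> t \<le> (c + 4) * Suc (s ''n'' 0) ^ Suc d" for s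
  proof -
    let ?s = "s(i := (s i)(0 := 0))" and ?N = "s ''n'' 0"
    have init: "exec (Write i (Num 0) (Num 0)) s 1 ?s"
      using exec.Write[of i "Num 0" "Num 0" s] by simp
    have n: "?s ''n'' 0 = ?N" "?s i 0 = 0" using assms(4) by auto
    obtain t s' where t: "exec (While ?b (Seq p ?inc)) ?s t s'"
      "t \<le> ?N * (c * Suc ?N ^ d + 2) + 1" using loop[of ?N ?s] n by auto
    have "exec (For i p) s (1 + t) s'"
      unfolding For_def using init t(1) by (rule exec.Seq)
    moreover have "1 + t \<le> (c + 4) * Suc ?N ^ Suc d"
    proof -
      have "1 \<le> Suc ?N ^ d" by (rule one_le_power) simp
      then have "c * Suc ?N ^ d + 2 \<le> c * Suc ?N ^ d + 2 * Suc ?N ^ d" by linarith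
      then have "c * Suc ?N ^ d + 2 \<le> (c + 2) * Suc ?N ^ d" by (simp only: distrib_right)
      then have "?N * (c * Suc ?N ^ d + 2) \<le> Suc ?N * ((c + 2) * Suc ?N ^ d)"
        by (intro mult_le_mono) auto
      also have "\<dots> = (c + 2) * Suc ?N ^ Suc d" by (simp add: algebra_simps)
      finally have "?N * (c * Suc ?N ^ d + 2) \<le> (c + 2) * Suc ?N ^ Suc d" .
      moreover have "1 \<le> Suc ?N ^ Suc d" by (rule one_le_power) simp
      moreover have "(c + 4) * Suc ?N ^ Suc d = (c + 2) * Suc ?N ^ Suc d + 2 * Suc ?N ^ Suc d"
        by (simp add: distrib_right)
      ultimately show ?thesis using t(2) by linarith
    qed
    ultimately show ?thesis by blast
  qed
  then show ?thesis unfolding poly_time_def by blast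
qed

lemmas poly_time_intros = poly_time_Skip poly_time_Write poly_time_Seq poly_time_Cond poly_time_For

text \<open>Termination is covered by \<open>poly_time\<close>, so partial correctness suffices.\<close>

definition wlp :: "com \<Rightarrow> (state \<Rightarrow> bool) \<Rightarrow> state \<Rightarrow> bool" where
  "wlp p Q s \<longleftrightarrow> (\<forall>t s'. exec p s t s' \<longrightarrow> Q s')"

lemma wlp_Skip [simp]: "wlp Skip Q s \<longleftrightarrow> Q s"
  unfolding wlp_def by (auto intro: exec.Skip elim: exec_elims(1))

lemma wlp_Write [simp]:
  "wlp (Write x i a) Q s \<longleftrightarrow> Q (s(x := (s x)(aval i s := aval a s)))"
  unfolding wlp_def by (auto intro: exec.Write elim: exec_elims(2))

lemma wlp_Seq [simp]: "wlp (Seq p q) Q = wlp p (wlp q Q)"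
  unfolding wlp_def fun_eq_iff by (auto intro: exec.Seq elim!: exec_elims(3))

lemma wlp_Cond [simp]:
  "wlp (Cond b p q) Q s \<longleftrightarrow> (if bval b s then wlp p Q s else wlp q Q s)"
  unfolding wlp_def
  by (auto elim!: exec_elims(4)) (meson exec.CondTrue exec.CondFalse)+

text \<open>The invariant need only speak of what the body changes: all other variables keep their
  initial values and are handed to the proof obligations as equations.\<close>

lemma wlp_For:
  assumes i: "i \<noteq> ''n''" "''n'' \<notin> writes p" "i \<notin> writes p"
    and init: "I 0 s"
    and stable: "\<And>m s f. I m s \<Longrightarrow> I m (s(i := f))"
    and step: "\<And>m s'. m < s ''n'' 0 \<Longrightarrow> s' i 0 = m \<Longrightarrow>
      (\<And>x. x \<noteq> i \<Longrightarrow> x \<notin> writes p \<Longrightarrow> s' x = s x) \<Longrightarrow> I m s' \<Longrightarrow> wlp p (I (Suc m)) s'"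
    and post: "\<And>s'. (\<And>x. x \<noteq> i \<Longrightarrow> x \<notin> writes p \<Longrightarrow> s' x = s x) \<Longrightarrow> I (s ''n'' 0) s' \<Longrightarrow> Q s'"
  shows "wlp (For i p) Q s"
proof -
  let ?b = "Less (Read i (Num 0)) (Read ''n'' (Num 0))"
  let ?inc = "Write i (Num 0) (Plus (Read i (Num 0)) (Num 1))"
  have loop: "Q s''"
    if "exec w s' t s''" "w = While ?b (Seq p ?inc)" "\<And>x. x \<noteq> i \<Longrightarrow> x \<notin> writes p \<Longrightarrow> s' x = s x"
      "s' i 0 \<le> s ''n'' 0" "I (s' i 0) s'" for w s' t s''
    using that
  proof (induction rule: exec.induct)
    case (WhileFalse b s' q)
    then have "s' i 0 = s ''n'' 0" using i by auto
    then show ?case using post[of s'] WhileFalse by auto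
  next
    case (WhileTrue b s1 q t s2 t' s3)
    then have b: "b = ?b" "q = Seq p ?inc" by auto
    then obtain u s1' where s1': "exec p s1 u s1'" "s2 = s1'(i := (s1' i)(0 := s1' i 0 + 1))"
      using WhileTrue.hyps(2) by (auto elim!: exec_elims(3) exec_elims(2))
    have fr: "s1' x = s1 x" if "x \<notin> writes p" for x using exec_frame[OF s1'(1) that] .
    have lt: "s1 i 0 < s ''n'' 0" using WhileTrue.hyps(1) WhileTrue.prems(2) b i by auto
    have "wlp p (I (Suc (s1 i 0))) s1"
      using step[OF lt refl WhileTrue.prems(2) WhileTrue.prems(4)] by blast
    then have "I (Suc (s1 i 0)) s1'" using s1'(1) by (auto simp: wlp_def)
    then have "I (s2 i 0) s2" using stable fr[OF i(3)] by (simp add: s1'(2))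
    moreover have "s2 x = s x" if "x \<noteq> i" "x \<notin> writes p" for x
      using that fr s1'(2) WhileTrue.prems(2) by auto
    moreover have "s2 i 0 \<le> s ''n'' 0" using lt fr[OF i(3)] by (simp add: s1'(2))
    ultimately show ?case using WhileTrue.IH(2) WhileTrue.prems(1) by blast
  qed auto
  show ?thesis
    unfolding For_def wlp_Seq wlp_Write unfolding wlp_def
    using loop stable[OF init] i by (intro allI impI) (erule loop, auto)
qed

section \<open>The coloring program\<close>

abbreviation var :: "string \<Rightarrow> aexp" where "var x \<equiv> Read x (Num 0)"

abbreviation put :: "string \<Rightarrow> aexp \<Rightarrow> com" where "put x a \<equiv> Write x (Num 0) a"

text \<open>There is no multiplication, so the row offsets \<open>i * n\<close> of the adjacency matrix are tabulated
  in advance by the next program.\<close>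

definition adjacent :: "string \<Rightarrow> string \<Rightarrow> bexp" where
  "adjacent i j = Equal (Read ''adj'' (Plus (Read ''row'' (var i)) (var j))) (Num 1)"

definition rows :: com where
  "rows = For ''i'' (Write ''row'' (Plus (var ''i'') (Num 1)) (Plus (Read ''row'' (var ''i'')) (var ''n'')))"

definition degrees :: com where
  "degrees = For ''i'' (For ''j'' (Cond (adjacent ''i'' ''j'')
     (Write ''deg'' (var ''i'') (Plus (Read ''deg'' (var ''i'')) (Num 1))) Skip))"

definition center :: com where
  "center = For ''i'' (Cond (Less (Read ''deg'' (var ''i'')) (var ''max'')) Skip
     (Seq (put ''max'' (Read ''deg'' (var ''i''))) (put ''v'' (var ''i''))))"

definition colors :: com where
  "colors = Seq (put ''k'' (var ''max'')) (For ''i'' (For ''j'' (Cond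
     (Conj (Neg (Equal (var ''i'') (var ''j''))) (Conj (Neg (adjacent ''i'' ''j''))
       (Conj (Equal (Read ''deg'' (var ''i'')) (var ''max'')) (Equal (Read ''deg'' (var ''j'')) (var ''max'')))))
     (put ''k'' (Plus (var ''max'') (Num 1))) Skip)))"

text \<open>Colors the center with \<open>0\<close>, the initial content of the memory, and its neighbors with
  \<open>1, 2, \<dots>\<close>.  Afterwards \<open>deg\<close> holds the degrees of the other vertices in the
  forest without the center.\<close>

definition star :: com where
  "star = Seq (Write ''done'' (var ''v'') (Num 1)) (For ''i'' (Cond (adjacent ''v'' ''i'')
     (Seq (put ''cnt'' (Plus (var ''cnt'') (Num 1)))
     (Seq (Write ''col'' (var ''i'') (var ''cnt''))
     (Seq (Write ''done'' (var ''i'') (Num 1))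
          (Write ''deg'' (var ''i'') (Minus (Read ''deg'' (var ''i'')) (Num 1)))))) Skip))"

text \<open>Tests whether color \<open>a + 1\<close> equals the color of a colored neighbor \<open>p\<close> of \<open>sel\<close> (the case
  \<open>x = y\<close>) or is already joined to it by the edge \<open>xy\<close>.\<close>

definition conflict :: com where
  "conflict = For ''p'' (For ''x'' (For ''y'' (Cond
     (Conj (adjacent ''sel'' ''p'') (Conj (Equal (Read ''done'' (var ''p'')) (Num 1))
     (Conj (Equal (Read ''done'' (var ''x'')) (Num 1)) (Conj (Equal (Read ''done'' (var ''y'')) (Num 1))
     (Conj (Neg (Conj (Neg (Equal (var ''x'') (var ''y''))) (Neg (adjacent ''x'' ''y''))))
     (Conj (Equal (Read ''col'' (var ''x'')) (Read ''col'' (var ''p'')))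
           (Equal (Read ''col'' (var ''y'')) (Plus (var ''a'') (Num 1)))))))))
     (put ''bad'' (Num 1)) Skip)))"

definition load :: com where
  "load = For ''x'' (Cond
     (Conj (Equal (Read ''done'' (var ''x'')) (Num 1))
           (Equal (Read ''col'' (var ''x'')) (Plus (var ''a'') (Num 1))))
     (put ''ld'' (Plus (var ''ld'') (Read ''deg'' (var ''x'')))) Skip)"

definition choose_color :: com where
  "choose_color = For ''a'' (Seq (put ''bad'' (Num 0)) (Seq (put ''ld'' (Num 0)) (Seq conflict (Seq load
     (Cond (Conj (Less (var ''a'') (var ''k'')) (Conj (Equal (var ''bad'') (Num 0))
         (Less (Plus (var ''ld'') (Read ''deg'' (var ''sel''))) (var ''k''))))
       (put ''best'' (Plus (var ''a'') (Num 1))) Skip)))))"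

definition paint :: com where
  "paint = Seq choose_color
     (Seq (Write ''col'' (var ''sel'') (var ''best'')) (Write ''done'' (var ''sel'') (Num 1)))"

text \<open>Selects an uncolored vertex of degree at least two, with a colored neighbor if possible; the
  value \<open>n\<close> signals that none is left.\<close>

definition select_branch :: com where
  "select_branch = Seq (put ''sel'' (var ''n''))
     (Seq (For ''u'' (Cond (Conj (Equal (Read ''done'' (var ''u'')) (Num 0)) (Less (Num 1) (Read ''deg'' (var ''u''))))
        (put ''sel'' (var ''u'')) Skip))
     (For ''u'' (For ''p'' (Cond
        (Conj (Equal (Read ''done'' (var ''u'')) (Num 0)) (Conj (Less (Num 1) (Read ''deg'' (var ''u'')))
        (Conj (adjacent ''u'' ''p'') (Equal (Read ''done'' (var ''p'')) (Num 1)))))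
        (put ''sel'' (var ''u'')) Skip))))"

definition branches :: com where
  "branches = For ''r'' (Seq select_branch (Cond (Less (var ''sel'') (var ''n'')) paint Skip))"

definition leaves :: com where
  "leaves = For ''r'' (Cond (Equal (Read ''done'' (var ''r'')) (Num 0)) (Seq (put ''sel'' (var ''r'')) paint) Skip)"

definition color_forest :: com where
  "color_forest = Seq rows (Seq degrees (Seq center (Seq colors (Seq star (Seq branches leaves)))))"

lemmas program_defs = rows_def degrees_def center_def colors_def star_def conflict_def load_def
  choose_color_def paint_def select_branch_def branches_def leaves_def color_forest_def

lemma poly_time_color_forest: "poly_time color_forest"
  unfolding program_defs by (intro poly_time_intros) simp_all

text \<open>The part of the state that stays fixed once the row offsets have been computed.\<close>

definition base :: "nat \<Rightarrow> nat set set \<Rightarrow> state \<Rightarrow> bool" where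
  "base N E s \<longleftrightarrow> s ''n'' 0 = N \<and> (\<forall>i<N. s ''row'' i = i * N) \<and>
     (\<forall>i<N. \<forall>j<N. s ''adj'' (i * N + j) = of_bool ({i, j} \<in> E))"

lemma base_n: "base N E s \<Longrightarrow> s ''n'' 0 = N"
  by (simp add: base_def)

lemma base_adjacent:
  "base N E s \<Longrightarrow> s i 0 < N \<Longrightarrow> s j 0 < N \<Longrightarrow> bval (adjacent i j) s \<longleftrightarrow> {s i 0, s j 0} \<in> E"
  by (simp add: base_def adjacent_def)

lemma base_frame:
  "base N E s \<Longrightarrow> s' ''n'' = s ''n'' \<Longrightarrow> s' ''row'' = s ''row'' \<Longrightarrow> s' ''adj'' = s ''adj'' \<Longrightarrow> base N E s'"
  by (simp add: base_def)

lemma card_less_Suc_if: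
  "card {j. j < Suc m \<and> P j} = card {j. j < m \<and> P j} + of_bool (P m)"
proof -
  have "{j. j < Suc m \<and> P j} = (if P m then insert m {j. j < m \<and> P j} else {j. j < m \<and> P j})"
    by (auto simp: less_Suc_eq)
  then show ?thesis by simp
qed

lemma degree_card:
  fixes E :: "nat set set"
  assumes "simple_graph {..<N} E"
  shows "degree E x = card {j. j < N \<and> {x, j} \<in> E}"
proof -
  have "{e \<in> E. x \<in> e} = (\<lambda>j. {x, j}) ` {j. j < N \<and> {x, j} \<in> E}"
  proof (rule set_eqI, rule iffI)
    fix e assume e: "e \<in> {e \<in> E. x \<in> e}"
    then obtain j where "e = {x, j}" "j \<in> {..<N}"
      using simple_graph_edge_at[OF assms, of e x] by (metis (no_types, lifting) mem_Collect_eq)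
    then show "e \<in> (\<lambda>j. {x, j}) ` {j. j < N \<and> {x, j} \<in> E}" using e by auto
  qed auto
  moreover have "inj_on (\<lambda>j. {x, j}) {j. j < N \<and> {x, j} \<in> E}"
    by (auto simp: inj_on_def doubleton_eq_iff)
  ultimately show ?thesis by (simp add: degree_def card_image)
qed

lemma ex_Suc: "(\<exists>y<Suc q. P y) \<longleftrightarrow> (\<exists>y<q. P y) \<or> P q"
  by (auto simp: less_Suc_eq)

lemma rows_correct:
  assumes n: "s ''n'' 0 = N" and zero: "s ''row'' 0 = 0"
    and post: "\<And>s'. (\<And>x. x \<notin> {''i'', ''row''} \<Longrightarrow> s' x = s x) \<Longrightarrow> \<forall>x<N. s' ''row'' x = x * N \<Longrightarrow> Q s'"
  shows "wlp rows Q s"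
  unfolding rows_def
proof (rule wlp_For[where I = "\<lambda>m s. \<forall>x\<le>m. s ''row'' x = x * N"])
  fix m s'
  assume fr: "\<And>x. x \<noteq> ''i'' \<Longrightarrow> x \<notin> writes (Write ''row'' (Plus (var ''i'') (Num 1)) (Plus (Read ''row'' (var ''i'')) (var ''n''))) \<Longrightarrow> s' x = s x"
    and i: "s' ''i'' 0 = m" and row: "\<forall>x\<le>m. s' ''row'' x = x * N"
  have "s' ''n'' 0 = N" using fr[of "''n''"] n by simp
  then show "wlp (Write ''row'' (Plus (var ''i'') (Num 1)) (Plus (Read ''row'' (var ''i'')) (var ''n'')))
      (\<lambda>s. \<forall>x\<le>Suc m. s ''row'' x = x * N) s'"
    using i row by (auto simp: le_Suc_eq)
qed (simp_all add: zero n, rule post, simp_all)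

lemma degrees_correct:
  assumes b: "base N E s" and zero: "s ''deg'' = (\<lambda>_. 0)" and sg: "simple_graph {..<N} E"
    and post: "\<And>s'. (\<And>x. x \<notin> {''i'', ''j'', ''deg''} \<Longrightarrow> s' x = s x) \<Longrightarrow>
      \<forall>x<N. s' ''deg'' x = degree E x \<Longrightarrow> Q s'"
  shows "wlp degrees Q s"
  unfolding degrees_def
proof (rule wlp_For[where I = "\<lambda>m s. s ''deg'' = (\<lambda>x. if x < m then degree E x else 0)"])
  fix m s1
  assume m: "m < s ''n'' 0" and i: "s1 ''i'' 0 = m"
    and fr: "\<And>x. x \<noteq> ''i'' \<Longrightarrow> x \<notin> writes (For ''j'' (Cond (adjacent ''i'' ''j'')
     (Write ''deg'' (var ''i'') (Plus (Read ''deg'' (var ''i'')) (Num 1))) Skip)) \<Longrightarrow> s1 x = s x"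
    and I: "s1 ''deg'' = (\<lambda>x. if x < m then degree E x else 0)"
  have b1: "base N E s1" by (rule base_frame[OF b]) (simp_all add: fr)
  have mN: "m < N" using m base_n[OF b] by simp
  show "wlp (For ''j'' (Cond (adjacent ''i'' ''j'')
     (Write ''deg'' (var ''i'') (Plus (Read ''deg'' (var ''i'')) (Num 1))) Skip))
     (\<lambda>s. s ''deg'' = (\<lambda>x. if x < Suc m then degree E x else 0)) s1"
  proof (rule wlp_For[where I = "\<lambda>l s. s ''deg'' = (\<lambda>x. if x < m then degree E x
      else if x = m then card {j. j < l \<and> {m, j} \<in> E} else 0)"])
    fix l s2
    assume l: "l < s1 ''n'' 0" and j: "s2 ''j'' 0 = l"
      and fr2: "\<And>x. x \<noteq> ''j'' \<Longrightarrow> x \<notin> writes (Cond (adjacent ''i'' ''j'')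
        (Write ''deg'' (var ''i'') (Plus (Read ''deg'' (var ''i'')) (Num 1))) Skip) \<Longrightarrow> s2 x = s1 x"
      and I2: "s2 ''deg'' = (\<lambda>x. if x < m then degree E x
        else if x = m then card {j. j < l \<and> {m, j} \<in> E} else 0)"
    have b2: "base N E s2" by (rule base_frame[OF b1]) (simp_all add: fr2)
    have i2: "s2 ''i'' 0 = m" using fr2[of "''i''"] i by simp
    have "bval (adjacent ''i'' ''j'') s2 \<longleftrightarrow> {m, l} \<in> E"
      using base_adjacent[OF b2, of "''i''" "''j''"] i2 j l base_n[OF b1] mN by simp
    then show "wlp (Cond (adjacent ''i'' ''j'')
        (Write ''deg'' (var ''i'') (Plus (Read ''deg'' (var ''i'')) (Num 1))) Skip)
        (\<lambda>s. s ''deg'' = (\<lambda>x. if x < m then degree E x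
          else if x = m then card {j. j < Suc l \<and> {m, j} \<in> E} else 0)) s2"
      using i2 I2 by (auto simp: card_less_Suc_if)
  qed (use I base_n[OF b1] degree_card[OF sg] in \<open>auto simp: less_Suc_eq fun_eq_iff\<close>)
qed (simp_all add: zero base_n[OF b], rule post, simp_all)

lemma center_correct:
  assumes n: "s ''n'' 0 = N" and zero: "s ''max'' 0 = 0" and N: "0 < N"
    and post: "\<And>s'. (\<And>x. x \<notin> {''i'', ''max'', ''v''} \<Longrightarrow> s' x = s x) \<Longrightarrow>
      s' ''v'' 0 < N \<Longrightarrow> s ''deg'' (s' ''v'' 0) = s' ''max'' 0 \<Longrightarrow>
      \<forall>x<N. s ''deg'' x \<le> s' ''max'' 0 \<Longrightarrow> Q s'"
  shows "wlp center Q s"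
  unfolding center_def
proof (rule wlp_For[where I = "\<lambda>m s'. (\<forall>x<m. s ''deg'' x \<le> s' ''max'' 0) \<and>
    (if m = 0 then s' ''max'' 0 = 0 else s' ''v'' 0 < m \<and> s ''deg'' (s' ''v'' 0) = s' ''max'' 0)"])
  fix m s'
  assume i: "s' ''i'' 0 = m"
    and fr: "\<And>x. x \<noteq> ''i'' \<Longrightarrow> x \<notin> writes (Cond (Less (Read ''deg'' (var ''i'')) (var ''max'')) Skip
     (Seq (put ''max'' (Read ''deg'' (var ''i''))) (put ''v'' (var ''i'')))) \<Longrightarrow> s' x = s x"
    and I: "(\<forall>x<m. s ''deg'' x \<le> s' ''max'' 0) \<and>
    (if m = 0 then s' ''max'' 0 = 0 else s' ''v'' 0 < m \<and> s ''deg'' (s' ''v'' 0) = s' ''max'' 0)"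
  have "s' ''deg'' = s ''deg''" by (simp add: fr)
  then show "wlp (Cond (Less (Read ''deg'' (var ''i'')) (var ''max'')) Skip
     (Seq (put ''max'' (Read ''deg'' (var ''i''))) (put ''v'' (var ''i''))))
     (\<lambda>s'. (\<forall>x<Suc m. s ''deg'' x \<le> s' ''max'' 0) \<and>
    (if Suc m = 0 then s' ''max'' 0 = 0 else s' ''v'' 0 < Suc m \<and> s ''deg'' (s' ''v'' 0) = s' ''max'' 0)) s'"
    using i I by (cases "s ''deg'' m < s' ''max'' 0") (auto simp: less_Suc_eq not_less split: if_splits intro: le_trans)
qed (simp_all add: n zero gr_implies_not0[OF N], rule post, simp_all)

lemma colors_correct:
  assumes b: "base N E s"
    and post: "\<And>s'. (\<And>x. x \<notin> {''i'', ''j'', ''k''} \<Longrightarrow> s' x = s x) \<Longrightarrow>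
      s' ''k'' 0 = s ''max'' 0 + of_bool (\<exists>i<N. \<exists>j<N. i \<noteq> j \<and> {i, j} \<notin> E \<and>
        s ''deg'' i = s ''max'' 0 \<and> s ''deg'' j = s ''max'' 0) \<Longrightarrow> Q s'"
  shows "wlp colors Q s"
proof -
  let ?M = "s ''max'' 0"
  let ?P = "\<lambda>i j. i \<noteq> j \<and> {i, j} \<notin> E \<and> s ''deg'' i = ?M \<and> s ''deg'' j = ?M"
  let ?body = "Cond (Conj (Neg (Equal (var ''i'') (var ''j''))) (Conj (Neg (adjacent ''i'' ''j''))
       (Conj (Equal (Read ''deg'' (var ''i'')) (var ''max'')) (Equal (Read ''deg'' (var ''j'')) (var ''max'')))))
     (put ''k'' (Plus (var ''max'') (Num 1))) Skip"
  let ?s = "s(''k'' := (s ''k'')(0 := ?M))"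
  have "wlp (For ''i'' (For ''j'' ?body)) Q ?s"
  proof (rule wlp_For[where I = "\<lambda>m t. t ''k'' 0 = ?M + of_bool (\<exists>i<m. \<exists>j<N. ?P i j)"])
    fix m s1
    assume m: "m < ?s ''n'' 0" and i: "s1 ''i'' 0 = m"
      and fr: "\<And>x. x \<noteq> ''i'' \<Longrightarrow> x \<notin> writes (For ''j'' ?body) \<Longrightarrow> s1 x = ?s x"
      and I: "s1 ''k'' 0 = ?M + of_bool (\<exists>i<m. \<exists>j<N. ?P i j)"
    have b1: "base N E s1" by (rule base_frame[OF b]) (simp_all add: fr)
    have mN: "m < N" using m base_n[OF b] by simp
    show "wlp (For ''j'' ?body) (\<lambda>t. t ''k'' 0 = ?M + of_bool (\<exists>i<Suc m. \<exists>j<N. ?P i j)) s1"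
    proof (rule wlp_For[where I = "\<lambda>l t. t ''k'' 0 = ?M + of_bool ((\<exists>i<m. \<exists>j<N. ?P i j) \<or> (\<exists>j<l. ?P m j))"])
      fix l s2
      assume l: "l < s1 ''n'' 0" and j: "s2 ''j'' 0 = l"
        and fr2: "\<And>x. x \<noteq> ''j'' \<Longrightarrow> x \<notin> writes ?body \<Longrightarrow> s2 x = s1 x"
        and I2: "s2 ''k'' 0 = ?M + of_bool ((\<exists>i<m. \<exists>j<N. ?P i j) \<or> (\<exists>j<l. ?P m j))"
      have b2: "base N E s2" by (rule base_frame[OF b1]) (simp_all add: fr2)
      have i2: "s2 ''i'' 0 = m" using fr2[of "''i''"] i by simp
      have "bval (adjacent ''i'' ''j'') s2 \<longleftrightarrow> {m, l} \<in> E"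
        using base_adjacent[OF b2, of "''i''" "''j''"] i2 j l base_n[OF b1] mN by simp
      moreover have "s2 ''deg'' = s ''deg''" "s2 ''max'' = s ''max''" by (simp_all add: fr fr2)
      ultimately show "wlp ?body (\<lambda>t. t ''k'' 0 = ?M + of_bool ((\<exists>i<m. \<exists>j<N. ?P i j) \<or> (\<exists>j<Suc l. ?P m j))) s2"
        using i2 j I2 by (auto simp: less_Suc_eq)
    qed (use I base_n[OF b1] in \<open>auto simp: less_Suc_eq\<close>)
  qed (simp_all add: base_n[OF b], rule post, simp_all)
  then show ?thesis by (simp add: colors_def)
qed

lemma star_correct:
  assumes b: "base N E s" and v: "s ''v'' 0 = v" "v < N" and loop: "{v, v} \<notin> E"
    and zero: "s ''cnt'' 0 = 0" "s ''col'' = (\<lambda>_. 0)" "s ''done'' = (\<lambda>_. 0)"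
    and post: "\<And>s'. (\<And>x. x \<notin> {''i'', ''done'', ''cnt'', ''col'', ''deg''} \<Longrightarrow> s' x = s x) \<Longrightarrow>
      s' ''done'' = (\<lambda>x. of_bool (x = v \<or> x < N \<and> {v, x} \<in> E)) \<Longrightarrow>
      s' ''col'' = (\<lambda>x. if x < N \<and> {v, x} \<in> E then card {j. j < Suc x \<and> {v, j} \<in> E} else 0) \<Longrightarrow>
      s' ''deg'' = (\<lambda>x. s ''deg'' x - of_bool (x < N \<and> {v, x} \<in> E)) \<Longrightarrow> Q s'"
  shows "wlp star Q s"
proof -
  let ?body = "Cond (adjacent ''v'' ''i'')
     (Seq (put ''cnt'' (Plus (var ''cnt'') (Num 1)))
     (Seq (Write ''col'' (var ''i'') (var ''cnt''))
     (Seq (Write ''done'' (var ''i'') (Num 1))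
          (Write ''deg'' (var ''i'') (Minus (Read ''deg'' (var ''i'')) (Num 1)))))) Skip"
  let ?s = "s(''done'' := (s ''done'')(v := 1))"
  let ?I = "\<lambda>m t. t ''cnt'' 0 = card {j. j < m \<and> {v, j} \<in> E} \<and>
    t ''done'' = (\<lambda>x. of_bool (x = v \<or> x < m \<and> {v, x} \<in> E)) \<and>
    t ''col'' = (\<lambda>x. if x < m \<and> {v, x} \<in> E then card {j. j < Suc x \<and> {v, j} \<in> E} else 0) \<and>
    t ''deg'' = (\<lambda>x. s ''deg'' x - of_bool (x < m \<and> {v, x} \<in> E))"
  have "wlp (For ''i'' ?body) Q ?s"
  proof (rule wlp_For[where I = ?I])
    fix m s1
    assume m: "m < ?s ''n'' 0" and i: "s1 ''i'' 0 = m"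
      and fr: "\<And>x. x \<noteq> ''i'' \<Longrightarrow> x \<notin> writes ?body \<Longrightarrow> s1 x = ?s x"
      and I: "?I m s1"
    have b1: "base N E s1" by (rule base_frame[OF b]) (simp_all add: fr)
    have v1: "s1 ''v'' 0 = v" using v by (simp add: fr)
    have "bval (adjacent ''v'' ''i'') s1 \<longleftrightarrow> {v, m} \<in> E"
      using base_adjacent[OF b1, of "''v''" "''i''"] i v1 m base_n[OF b] v by simp
    then show "wlp ?body (?I (Suc m)) s1"
      using i I card_less_Suc_if[of m "\<lambda>j. {v, j} \<in> E"]
      by (cases "{v, m} \<in> E") (auto simp: fun_eq_iff less_Suc_eq)
  next
    show "?I 0 ?s" using zero by (auto simp: fun_eq_iff)
  qed (simp_all add: base_n[OF b], rule post, simp_all)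
  then show ?thesis using v by (simp add: star_def)
qed

text \<open>The test that \<open>conflict\<close> performs for fixed \<open>p\<close>, \<open>x\<close> and \<open>y\<close>.\<close>

definition clash :: "nat \<Rightarrow> nat set set \<Rightarrow> state \<Rightarrow> nat \<Rightarrow> nat \<Rightarrow> nat \<Rightarrow> nat \<Rightarrow> nat \<Rightarrow> bool" where
  "clash N E s w a p x y \<longleftrightarrow> {w, p} \<in> E \<and> s ''done'' p = 1 \<and> s ''done'' x = 1 \<and> s ''done'' y = 1 \<and>
     (x = y \<or> {x, y} \<in> E) \<and> s ''col'' x = s ''col'' p \<and> s ''col'' y = Suc a"

lemma conflict_correct:
  assumes b: "base N E s" and w: "s ''sel'' 0 = w" "w < N" and a: "s ''a'' 0 = a" and bad: "s ''bad'' 0 = 0"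
    and post: "\<And>s'. (\<And>x. x \<notin> {''p'', ''x'', ''y'', ''bad''} \<Longrightarrow> s' x = s x) \<Longrightarrow>
      s' ''bad'' 0 = of_bool (\<exists>p<N. \<exists>x<N. \<exists>y<N. clash N E s w a p x y) \<Longrightarrow> Q s'"
  shows "wlp conflict Q s"
proof -
  let ?P = "clash N E s w a"
  let ?test = "Conj (adjacent ''sel'' ''p'') (Conj (Equal (Read ''done'' (var ''p'')) (Num 1))
     (Conj (Equal (Read ''done'' (var ''x'')) (Num 1)) (Conj (Equal (Read ''done'' (var ''y'')) (Num 1))
     (Conj (Neg (Conj (Neg (Equal (var ''x'') (var ''y''))) (Neg (adjacent ''x'' ''y''))))
     (Conj (Equal (Read ''col'' (var ''x'')) (Read ''col'' (var ''p'')))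
           (Equal (Read ''col'' (var ''y'')) (Plus (var ''a'') (Num 1))))))))"
  let ?body = "Cond ?test (put ''bad'' (Num 1)) Skip"
  show ?thesis
    unfolding conflict_def
  proof (rule wlp_For[where I = "\<lambda>m t. t ''bad'' 0 = of_bool (\<exists>p<m. \<exists>x<N. \<exists>y<N. ?P p x y)"])
    fix m s1
    assume m: "m < s ''n'' 0" and p: "s1 ''p'' 0 = m"
      and fr: "\<And>x. x \<noteq> ''p'' \<Longrightarrow> x \<notin> writes (For ''x'' (For ''y'' ?body)) \<Longrightarrow> s1 x = s x"
      and I: "s1 ''bad'' 0 = of_bool (\<exists>p<m. \<exists>x<N. \<exists>y<N. ?P p x y)"
    have b1: "base N E s1" by (rule base_frame[OF b]) (simp_all add: fr)
    show "wlp (For ''x'' (For ''y'' ?body)) (\<lambda>t. t ''bad'' 0 = of_bool (\<exists>p<Suc m. \<exists>x<N. \<exists>y<N. ?P p x y)) s1"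
    proof (rule wlp_For[where I = "\<lambda>l t. t ''bad'' 0 =
        of_bool ((\<exists>p<m. \<exists>x<N. \<exists>y<N. ?P p x y) \<or> (\<exists>x<l. \<exists>y<N. ?P m x y))"])
      fix l s2
      assume l: "l < s1 ''n'' 0" and x: "s2 ''x'' 0 = l"
        and fr2: "\<And>x. x \<noteq> ''x'' \<Longrightarrow> x \<notin> writes (For ''y'' ?body) \<Longrightarrow> s2 x = s1 x"
        and I2: "s2 ''bad'' 0 = of_bool ((\<exists>p<m. \<exists>x<N. \<exists>y<N. ?P p x y) \<or> (\<exists>x<l. \<exists>y<N. ?P m x y))"
      have b2: "base N E s2" by (rule base_frame[OF b1]) (simp_all add: fr2)
      show "wlp (For ''y'' ?body) (\<lambda>t. t ''bad'' 0 =
          of_bool ((\<exists>p<m. \<exists>x<N. \<exists>y<N. ?P p x y) \<or> (\<exists>x<Suc l. \<exists>y<N. ?P m x y))) s2"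
      proof (rule wlp_For[where I = "\<lambda>q t. t ''bad'' 0 = of_bool (((\<exists>p<m. \<exists>x<N. \<exists>y<N. ?P p x y) \<or>
          (\<exists>x<l. \<exists>y<N. ?P m x y)) \<or> (\<exists>y<q. ?P m l y))"])
        fix q s3
        assume q: "q < s2 ''n'' 0" and y: "s3 ''y'' 0 = q"
          and fr3: "\<And>x. x \<noteq> ''y'' \<Longrightarrow> x \<notin> writes ?body \<Longrightarrow> s3 x = s2 x"
          and I3: "s3 ''bad'' 0 = of_bool (((\<exists>p<m. \<exists>x<N. \<exists>y<N. ?P p x y) \<or>
            (\<exists>x<l. \<exists>y<N. ?P m x y)) \<or> (\<exists>y<q. ?P m l y))"
        have b3: "base N E s3" by (rule base_frame[OF b2]) (simp_all add: fr3)
        have vars: "s3 ''p'' 0 = m" "s3 ''x'' 0 = l" "s3 ''sel'' 0 = w" "s3 ''a'' 0 = a"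
          "s3 ''done'' = s ''done''" "s3 ''col'' = s ''col''"
          using p x w a by (simp_all add: fr fr2 fr3)
        have lt: "m < N" "l < N" "q < N" using m l q base_n[OF b] base_n[OF b1] base_n[OF b2] by auto
        have "bval (adjacent ''sel'' ''p'') s3 \<longleftrightarrow> {w, m} \<in> E"
          "bval (adjacent ''x'' ''y'') s3 \<longleftrightarrow> {l, q} \<in> E"
          using base_adjacent[OF b3, of "''sel''" "''p''"] base_adjacent[OF b3, of "''x''" "''y''"] vars y lt w
          by simp_all
        then have test: "bval ?test s3 \<longleftrightarrow> ?P m l q" using vars y by (simp add: clash_def)
        show "wlp ?body (\<lambda>t. t ''bad'' 0 = of_bool (((\<exists>p<m. \<exists>x<N. \<exists>y<N. ?P p x y) \<or>
            (\<exists>x<l. \<exists>y<N. ?P m x y)) \<or> (\<exists>y<Suc q. ?P m l y))) s3"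
          unfolding wlp_Cond test ex_Suc using I3 by (cases "?P m l q") simp_all
      qed (simp_all add: I2 base_n[OF b2] ex_Suc disj_assoc)
    qed (simp_all add: I base_n[OF b1] ex_Suc)
  qed (simp_all add: bad base_n[OF b], rule post, simp_all)
qed

lemma load_correct:
  assumes n: "s ''n'' 0 = N" and a: "s ''a'' 0 = a" and ld: "s ''ld'' 0 = 0"
    and post: "\<And>s'. (\<And>x. x \<notin> {''x'', ''ld''} \<Longrightarrow> s' x = s x) \<Longrightarrow>
      s' ''ld'' 0 = (\<Sum>x | x < N \<and> s ''done'' x = 1 \<and> s ''col'' x = Suc a. s ''deg'' x) \<Longrightarrow> Q s'"
  shows "wlp load Q s"
  unfolding load_def
proof (rule wlp_For[where I = "\<lambda>m t. t ''ld'' 0 =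
    (\<Sum>x | x < m \<and> s ''done'' x = 1 \<and> s ''col'' x = Suc a. s ''deg'' x)"])
  fix m s'
  let ?body = "Cond (Conj (Equal (Read ''done'' (var ''x'')) (Num 1))
           (Equal (Read ''col'' (var ''x'')) (Plus (var ''a'') (Num 1))))
     (put ''ld'' (Plus (var ''ld'') (Read ''deg'' (var ''x'')))) Skip"
  let ?P = "\<lambda>x. s ''done'' x = 1 \<and> s ''col'' x = Suc a"
  assume x: "s' ''x'' 0 = m"
    and fr: "\<And>x. x \<noteq> ''x'' \<Longrightarrow> x \<notin> writes ?body \<Longrightarrow> s' x = s x"
    and I: "s' ''ld'' 0 = (\<Sum>x | x < m \<and> s ''done'' x = 1 \<and> s ''col'' x = Suc a. s ''deg'' x)"
  have vars: "s' ''done'' = s ''done''" "s' ''col'' = s ''col''" "s' ''deg'' = s ''deg''" "s' ''a'' = s ''a''"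
    by (simp_all add: fr)
  have "{x. x < Suc m \<and> ?P x} = (if ?P m then insert m {x. x < m \<and> ?P x} else {x. x < m \<and> ?P x})"
    by (auto simp: less_Suc_eq)
  then have "(\<Sum>x | x < Suc m \<and> ?P x. s ''deg'' x) =
      (\<Sum>x | x < m \<and> ?P x. s ''deg'' x) + (if ?P m then s ''deg'' m else 0)"
    by simp
  then show "wlp ?body (\<lambda>t. t ''ld'' 0 =
    (\<Sum>x | x < Suc m \<and> s ''done'' x = 1 \<and> s ''col'' x = Suc a. s ''deg'' x)) s'"
    using I x a vars by simp
qed (simp_all add: n ld, rule post, simp_all)

text \<open>The colors that \<open>choose_color\<close> accepts, shifted down by one.\<close>

definition admissible :: "nat \<Rightarrow> nat set set \<Rightarrow> state \<Rightarrow> nat \<Rightarrow> nat \<Rightarrow> bool" where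
  "admissible N E s w a \<longleftrightarrow> a < s ''k'' 0 \<and> \<not> (\<exists>p<N. \<exists>x<N. \<exists>y<N. clash N E s w a p x y) \<and>
     (\<Sum>x | x < N \<and> s ''done'' x = 1 \<and> s ''col'' x = Suc a. s ''deg'' x) + s ''deg'' w < s ''k'' 0"

lemma paint_correct:
  assumes b: "base N E s" and w: "s ''sel'' 0 = w" "w < N" and k: "s ''k'' 0 \<le> N"
    and ex: "\<exists>a. admissible N E s w a"
    and post: "\<And>s' a. (\<And>x. x \<notin> {''a'', ''p'', ''x'', ''y'', ''bad'', ''ld'', ''best'', ''col'', ''done''} \<Longrightarrow> s' x = s x) \<Longrightarrow>
      admissible N E s w a \<Longrightarrow> s' ''col'' = (s ''col'')(w := Suc a) \<Longrightarrow> s' ''done'' = (s ''done'')(w := 1) \<Longrightarrow> Q s'"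
  shows "wlp paint Q s"
proof -
  let ?body = "Seq (put ''bad'' (Num 0)) (Seq (put ''ld'' (Num 0)) (Seq conflict (Seq load
     (Cond (Conj (Less (var ''a'') (var ''k'')) (Conj (Equal (var ''bad'') (Num 0))
         (Less (Plus (var ''ld'') (Read ''deg'' (var ''sel''))) (var ''k''))))
       (put ''best'' (Plus (var ''a'') (Num 1))) Skip))))"
  let ?I = "\<lambda>m t. (\<exists>a<m. admissible N E s w a) \<longrightarrow> (\<exists>a. admissible N E s w a \<and> t ''best'' 0 = Suc a)"
  let ?R = "wlp (Seq (Write ''col'' (var ''sel'') (var ''best'')) (Write ''done'' (var ''sel'') (Num 1))) Q"
  have "wlp choose_color ?R s"
    unfolding choose_color_def
  proof (rule wlp_For[where I = ?I])
    fix m s1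
    assume a: "s1 ''a'' 0 = m" and I: "?I m s1"
      and fr: "\<And>x. x \<noteq> ''a'' \<Longrightarrow> x \<notin> writes ?body \<Longrightarrow> s1 x = s x"
    define s2 where "s2 = s1(''bad'' := (s1 ''bad'')(0 := 0), ''ld'' := (s1 ''ld'')(0 := 0))"
    have b2: "base N E s2"
      by (rule base_frame[OF b]) (simp_all add: fr s2_def conflict_def load_def)
    have vars: "s2 ''sel'' = s ''sel''" "s2 ''done'' = s ''done''" "s2 ''col'' = s ''col''"
      "s2 ''deg'' = s ''deg''" "s2 ''k'' = s ''k''" "s2 ''a'' 0 = m" "s2 ''bad'' 0 = 0" "s2 ''ld'' 0 = 0"
      "s2 ''best'' = s1 ''best''"
      using a by (simp_all add: fr s2_def conflict_def load_def)
    have cl: "clash N E s2 w m = clash N E s w m" by (simp add: clash_def fun_eq_iff vars)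
    have "wlp conflict (wlp load (wlp (Cond (Conj (Less (var ''a'') (var ''k'')) (Conj (Equal (var ''bad'') (Num 0))
         (Less (Plus (var ''ld'') (Read ''deg'' (var ''sel''))) (var ''k''))))
       (put ''best'' (Plus (var ''a'') (Num 1))) Skip) (?I (Suc m)))) s2"
    proof (rule conflict_correct[OF b2 _ w(2) vars(6,7)])
      show "s2 ''sel'' 0 = w" using vars w by simp
    next
      fix s3
      assume fr3: "\<And>x. x \<notin> {''p'', ''x'', ''y'', ''bad''} \<Longrightarrow> s3 x = s2 x"
        and bad: "s3 ''bad'' 0 = of_bool (\<exists>p<N. \<exists>x<N. \<exists>y<N. clash N E s2 w m p x y)"
      show "wlp load (wlp (Cond (Conj (Less (var ''a'') (var ''k'')) (Conj (Equal (var ''bad'') (Num 0))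
         (Less (Plus (var ''ld'') (Read ''deg'' (var ''sel''))) (var ''k''))))
       (put ''best'' (Plus (var ''a'') (Num 1))) Skip) (?I (Suc m))) s3"
      proof (rule load_correct)
        show "s3 ''n'' 0 = N" "s3 ''a'' 0 = m" "s3 ''ld'' 0 = 0"
          using base_n[OF b2] vars by (simp_all add: fr3)
      next
        fix s4
        assume fr4: "\<And>x. x \<notin> {''x'', ''ld''} \<Longrightarrow> s4 x = s3 x"
          and ld: "s4 ''ld'' 0 = (\<Sum>x | x < N \<and> s3 ''done'' x = 1 \<and> s3 ''col'' x = Suc m. s3 ''deg'' x)"
        have vars4: "s4 ''a'' 0 = m" "s4 ''k'' = s ''k''" "s4 ''sel'' = s ''sel''" "s4 ''deg'' = s ''deg''"
          "s3 ''done'' = s ''done''" "s3 ''col'' = s ''col''" "s3 ''deg'' = s ''deg''"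
          "s4 ''best'' = s1 ''best''" "s4 ''bad'' 0 = s3 ''bad'' 0"
          using vars by (simp_all add: fr3 fr4)
        have "(s4 ''a'' 0 < s4 ''k'' 0 \<and> s4 ''bad'' 0 = 0 \<and>
            s4 ''ld'' 0 + s4 ''deg'' (s4 ''sel'' 0) < s4 ''k'' 0) \<longleftrightarrow> admissible N E s w m"
          unfolding admissible_def using vars4 bad ld cl w by auto
        then show "wlp (Cond (Conj (Less (var ''a'') (var ''k'')) (Conj (Equal (var ''bad'') (Num 0))
         (Less (Plus (var ''ld'') (Read ''deg'' (var ''sel''))) (var ''k''))))
       (put ''best'' (Plus (var ''a'') (Num 1))) Skip) (?I (Suc m)) s4"
          using I vars4 by (auto simp: less_Suc_eq)
      qed
    qed
    then show "wlp ?body (?I (Suc m)) s1" by (simp add: s2_def)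
  next
    fix s'
    assume fr: "\<And>x. x \<noteq> ''a'' \<Longrightarrow> x \<notin> writes ?body \<Longrightarrow> s' x = s x" and I: "?I (s ''n'' 0) s'"
    have "\<exists>a<s ''n'' 0. admissible N E s w a"
      using ex k base_n[OF b] by (auto simp: admissible_def intro: less_le_trans)
    then obtain a where a: "admissible N E s w a" "s' ''best'' 0 = Suc a" using I by blast
    have vars: "s' ''sel'' 0 = w" "s' ''col'' = s ''col''" "s' ''done'' = s ''done''"
      using w by (simp_all add: fr conflict_def load_def)
    have fr': "s' x = s x" if "x \<notin> {''a'', ''p'', ''x'', ''y'', ''bad'', ''ld'', ''best'', ''col'', ''done''}" for x
      using that by (simp add: fr conflict_def load_def)
    show "?R s'"
      unfolding wlp_Seq wlp_Write
      by (rule post[OF _ a(1)]) (use vars a fr' in auto)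
  qed (auto simp: conflict_def load_def)
  then show ?thesis by (simp add: paint_def)
qed

lemma select_branch_correct:
  assumes b: "base N E s"
    and B: "\<And>u. B u \<longleftrightarrow> u < N \<and> s ''done'' u = 0 \<and> 1 < s ''deg'' u"
    and L: "\<And>u. L u \<longleftrightarrow> B u \<and> (\<exists>p<N. {u, p} \<in> E \<and> s ''done'' p = 1)"
    and post: "\<And>s'. (\<And>x. x \<notin> {''u'', ''p'', ''sel''} \<Longrightarrow> s' x = s x) \<Longrightarrow>
      (if \<exists>u. L u then L (s' ''sel'' 0) else if \<exists>u. B u then B (s' ''sel'' 0) else s' ''sel'' 0 = N) \<Longrightarrow> Q s'"
  shows "wlp select_branch Q s"
proof -
  let ?test1 = "Conj (Equal (Read ''done'' (var ''u'')) (Num 0)) (Less (Num 1) (Read ''deg'' (var ''u'')))"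
  let ?body1 = "Cond ?test1 (put ''sel'' (var ''u'')) Skip"
  let ?test2 = "Conj (Equal (Read ''done'' (var ''u'')) (Num 0)) (Conj (Less (Num 1) (Read ''deg'' (var ''u'')))
        (Conj (adjacent ''u'' ''p'') (Equal (Read ''done'' (var ''p'')) (Num 1))))"
  let ?body2 = "Cond ?test2 (put ''sel'' (var ''u'')) Skip"
  let ?R = "\<lambda>t::state. if \<exists>u<N. B u then B (t ''sel'' 0) else t ''sel'' 0 = N"
  let ?A = "\<lambda>u p. B u \<and> {u, p} \<in> E \<and> s ''done'' p = 1"
  have BN: "(\<exists>u<N. B u) \<longleftrightarrow> (\<exists>u. B u)" "(\<exists>u<N. L u) \<longleftrightarrow> (\<exists>u. L u)" using B L by auto
  define s0 where "s0 = s(''sel'' := (s ''sel'')(0 := N))"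
  have b0: "base N E s0" by (rule base_frame[OF b]) (simp_all add: s0_def)
  have "wlp (For ''u'' ?body1) (wlp (For ''u'' (For ''p'' ?body2)) Q) s0"
  proof (rule wlp_For[where I = "\<lambda>m t. if \<exists>u<m. B u then B (t ''sel'' 0) else t ''sel'' 0 = N"])
    fix m s1
    assume m: "m < s0 ''n'' 0" and u: "s1 ''u'' 0 = m"
      and fr: "\<And>x. x \<noteq> ''u'' \<Longrightarrow> x \<notin> writes ?body1 \<Longrightarrow> s1 x = s0 x"
      and I: "if \<exists>u<m. B u then B (s1 ''sel'' 0) else s1 ''sel'' 0 = N"
    have "s1 ''done'' = s ''done''" "s1 ''deg'' = s ''deg''" by (simp_all add: fr s0_def)
    then have test: "bval ?test1 s1 \<longleftrightarrow> B m" using u m base_n[OF b0] B by simp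
    show "wlp ?body1 (\<lambda>t. if \<exists>u<Suc m. B u then B (t ''sel'' 0) else t ''sel'' 0 = N) s1"
      unfolding wlp_Cond test ex_Suc using I u by (cases "B m") (simp_all split: if_splits)
  next
    fix s1
    assume fr: "\<And>x. x \<noteq> ''u'' \<Longrightarrow> x \<notin> writes ?body1 \<Longrightarrow> s1 x = s0 x"
      and I: "if \<exists>u<s0 ''n'' 0. B u then B (s1 ''sel'' 0) else s1 ''sel'' 0 = N"
    have R1: "?R s1" using I base_n[OF b0] by simp
    have b1: "base N E s1" by (rule base_frame[OF b0]) (simp_all add: fr)
    have v1: "s1 ''done'' = s ''done''" "s1 ''deg'' = s ''deg''" by (simp_all add: fr s0_def)
    show "wlp (For ''u'' (For ''p'' ?body2)) Q s1"
    proof (rule wlp_For[where I = "\<lambda>m t. if \<exists>u<m. L u then L (t ''sel'' 0) else ?R t"])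
      fix m s2
      assume m: "m < s1 ''n'' 0" and u: "s2 ''u'' 0 = m"
        and fr2: "\<And>x. x \<noteq> ''u'' \<Longrightarrow> x \<notin> writes (For ''p'' ?body2) \<Longrightarrow> s2 x = s1 x"
        and I2: "if \<exists>u<m. L u then L (s2 ''sel'' 0) else ?R s2"
      have b2: "base N E s2" by (rule base_frame[OF b1]) (simp_all add: fr2)
      have mN: "m < N" using m base_n[OF b1] by simp
      have Lm: "L m \<longleftrightarrow> (\<exists>p<N. ?A m p)" using L by blast
      show "wlp (For ''p'' ?body2) (\<lambda>t. if \<exists>u<Suc m. L u then L (t ''sel'' 0) else ?R t) s2"
      proof (rule wlp_For[where I = "\<lambda>l t. if (\<exists>u<m. L u) \<or> (\<exists>p<l. ?A m p) then L (t ''sel'' 0) else ?R t"])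
        fix l s3
        assume l: "l < s2 ''n'' 0" and p: "s3 ''p'' 0 = l"
          and fr3: "\<And>x. x \<noteq> ''p'' \<Longrightarrow> x \<notin> writes ?body2 \<Longrightarrow> s3 x = s2 x"
          and I3: "if (\<exists>u<m. L u) \<or> (\<exists>p<l. ?A m p) then L (s3 ''sel'' 0) else ?R s3"
        have b3: "base N E s3" by (rule base_frame[OF b2]) (simp_all add: fr3)
        have v3: "s3 ''done'' = s ''done''" "s3 ''deg'' = s ''deg''" "s3 ''u'' 0 = m"
          using v1 u by (simp_all add: fr2 fr3)
        have lN: "l < N" using l base_n[OF b2] by simp
        have "bval (adjacent ''u'' ''p'') s3 \<longleftrightarrow> {m, l} \<in> E"
          using base_adjacent[OF b3, of "''u''" "''p''"] v3 p lN mN by simp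
        then have test: "bval ?test2 s3 \<longleftrightarrow> ?A m l" using v3 p mN by (auto simp: B)
        have "?A m l \<Longrightarrow> L m" using L lN by blast
        then show "wlp ?body2 (\<lambda>t. if (\<exists>u<m. L u) \<or> (\<exists>p<Suc l. ?A m p) then L (t ''sel'' 0) else ?R t) s3"
          unfolding wlp_Cond test ex_Suc using I3 v3 by (cases "?A m l") auto
      qed (use I2 base_n[OF b2] Lm in \<open>simp_all add: ex_Suc\<close>)
    next
      fix s'
      assume fr2: "\<And>x. x \<noteq> ''u'' \<Longrightarrow> x \<notin> writes (For ''p'' ?body2) \<Longrightarrow> s' x = s1 x"
        and I2: "if \<exists>u<s1 ''n'' 0. L u then L (s' ''sel'' 0) else ?R s'"
      show "Q s'"
      proof (rule post)
        show "\<And>x. x \<notin> {''u'', ''p'', ''sel''} \<Longrightarrow> s' x = s x" by (simp add: fr fr2 s0_def)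
        show "if \<exists>u. L u then L (s' ''sel'' 0) else if \<exists>u. B u then B (s' ''sel'' 0) else s' ''sel'' 0 = N"
          using I2 unfolding base_n[OF b1] BN .
      qed
    qed (use R1 in simp_all)
  qed (simp_all add: s0_def)
  then show ?thesis by (simp add: select_branch_def s0_def base_n[OF b])
qed

locale running = big_star "{..<N}" E v k for N :: nat and E v k
begin

definition painted :: "state \<Rightarrow> nat set" where
  "painted s = {u. u < N \<and> u \<noteq> v \<and> s ''done'' u = 1}"

text \<open>The state represents a good partial coloring of the rest of the forest, together with the
  coloring of the star.  The center is marked as done although it is no vertex of the rest.\<close>

definition ready :: "state \<Rightarrow> bool" where
  "ready s \<longleftrightarrow> base N E s \<and> s ''k'' 0 = k \<and> (\<forall>u<N. u \<noteq> v \<longrightarrow> s ''deg'' u = degree rest u) \<and>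
     (\<forall>u. s ''done'' u \<le> 1) \<and> s ''done'' v = 1 \<and> s ''col'' v = 0 \<and>
     nbrs \<subseteq> painted s \<and> inj_on (s ''col'') nbrs \<and> good (painted s) (s ''col'')"

lemma k_le: "k \<le> N"
proof -
  have "card nbrs \<le> card ({..<N} - {v})" using nbrs_subset by (intro card_mono) auto
  then show ?thesis using card_nbrs k v by auto
qed

lemma unpainted:
  assumes "ready s" "w < N" "s ''done'' w = 0"
  shows "w \<in> {..<N} - {v} - painted s" "w \<notin> nbrs" "s ''deg'' w = degree rest w"
  using assms by (auto simp: ready_def painted_def)

lemma unpainted_iff:
  assumes "ready s" "w < N"
  shows "s ''done'' w = 0 \<longleftrightarrow> w \<in> {..<N} - {v} - painted s"
  using assms by (auto simp: ready_def painted_def le_Suc_eq)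

lemma link_iff:
  assumes r: "ready s" and w: "w < N" "s ''done'' w = 0"
  shows "p < N \<and> {w, p} \<in> E \<and> s ''done'' p = 1 \<longleftrightarrow> p \<in> painted s \<and> {w, p} \<in> rest"
  using unpainted[OF assms] by (auto simp: painted_def rest_def nbrs_def insert_commute)

text \<open>The program inspects the whole forest instead of the rest.  This makes no difference, because
  the color \<open>0\<close> keeps the center out of all classes and \<open>w\<close> is not a neighbor of it.\<close>

lemma admissible_iff_fits:
  assumes r: "ready s" and w: "w < N" "s ''done'' w = 0"
  shows "admissible N E s w a \<longleftrightarrow> fits (painted s) (s ''col'') w (Suc a)"
proof -
  let ?C = "painted s" and ?c = "s ''col''"
  have g: "good ?C ?c" and kk: "s ''k'' 0 = k" and cv: "?c v = 0" using r by (auto simp: ready_def)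
  have pos: "0 < ?c p" if "p \<in> ?C" for p using g that unfolding good_def by force
  have C: "u \<in> ?C" if "u < N" "s ''done'' u = 1" "0 < ?c u" for u
    using that cv by (cases "u = v") (auto simp: painted_def)
  have CN: "u < N" "s ''done'' u = 1" "u \<noteq> v" if "u \<in> ?C" for u using that by (auto simp: painted_def)
  have "{x. x < N \<and> s ''done'' x = 1 \<and> ?c x = Suc a} = {x. x \<in> ?C \<and> ?c x = Suc a}"
    using C CN by auto
  then have load: "(\<Sum>x | x < N \<and> s ''done'' x = 1 \<and> ?c x = Suc a. s ''deg'' x) = card (touch rest ?C ?c (Suc a))"
    unfolding load_sum[OF g] using r CN by (auto simp: ready_def intro!: sum.cong)
  have "(\<exists>p<N. \<exists>x<N. \<exists>y<N. clash N E s w a p x y) \<longleftrightarrow>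
    (\<exists>p\<in>?C. {w, p} \<in> rest \<and> (?c p = Suc a \<or> touch rest ?C ?c (?c p) \<inter> touch rest ?C ?c (Suc a) \<noteq> {}))"
    (is "?L \<longleftrightarrow> ?R")
  proof
    assume ?L
    then obtain p x y where xy: "p < N" "x < N" "y < N" "clash N E s w a p x y" by blast
    then have p: "p \<in> ?C" "{w, p} \<in> rest" using link_iff[OF assms, of p] by (auto simp: clash_def)
    have x: "x \<in> ?C" "?c x = ?c p" using C[of x] pos[OF p(1)] xy by (auto simp: clash_def)
    have y: "y \<in> ?C" "?c y = Suc a" using C[of y] xy by (auto simp: clash_def)
    show ?R
    proof (cases "x = y")
      case True
      then show ?thesis using p x y by auto
    next
      case False
      then have "{x, y} \<in> rest" using xy CN(3)[OF x(1)] CN(3)[OF y(1)] by (auto simp: clash_def rest_def)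
      then have "{x, y} \<in> touch rest ?C ?c (?c p) \<inter> touch rest ?C ?c (Suc a)"
        using x y by (auto simp: touch_def)
      then show ?thesis using p by blast
    qed
  next
    assume ?R
    then obtain p where p: "p \<in> ?C" "{w, p} \<in> rest"
      and or: "?c p = Suc a \<or> touch rest ?C ?c (?c p) \<inter> touch rest ?C ?c (Suc a) \<noteq> {}" by blast
    have pE: "p < N" "{w, p} \<in> E" "s ''done'' p = 1" using link_iff[OF assms, of p] p by auto
    show ?L
    proof (cases "?c p = Suc a")
      case True
      then have "clash N E s w a p p p" using pE by (simp add: clash_def)
      then show ?thesis using pE by blast
    next
      case False
      then obtain e where "e \<in> touch rest ?C ?c (?c p)" "e \<in> touch rest ?C ?c (Suc a)" using or by blast
      then obtain x y where xy: "e = {x, y}" "x \<in> ?C" "y \<in> ?C" "?c x = ?c p" "?c y = Suc a" "e \<in> rest"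
        using touch_both[OF _ _ False] by metis
      then have "clash N E s w a p x y" using pE CN by (auto simp: clash_def rest_def)
      then show ?thesis using pE CN xy by blast
    qed
  qed
  then show ?thesis
    unfolding admissible_def fits_def load kk unpainted(3)[OF assms]
    by (auto simp: Suc_le_eq)
qed

lemma ready_frame:
  assumes "ready s" "\<And>x. x \<in> {''n'', ''row'', ''adj'', ''k'', ''deg'', ''done'', ''col''} \<Longrightarrow> s' x = s x"
  shows "ready s'" "painted s' = painted s"
proof -
  have eq: "s' ''n'' = s ''n''" "s' ''row'' = s ''row''" "s' ''adj'' = s ''adj''" "s' ''k'' = s ''k''"
    "s' ''deg'' = s ''deg''" "s' ''done'' = s ''done''" "s' ''col'' = s ''col''"
    using assms(2) by simp_all
  show "painted s' = painted s" by (simp add: painted_def eq)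
  then show "ready s'" using assms(1) base_frame[of N E s s'] by (simp add: ready_def eq)
qed

lemma paint_ready:
  assumes r: "ready s" and w: "s ''sel'' 0 = w" "w < N" "s ''done'' w = 0"
    and st: "step (painted s) (s ''col'') w"
    and post: "\<And>s'. (\<And>x. x \<notin> {''a'', ''p'', ''x'', ''y'', ''bad'', ''ld'', ''best'', ''col'', ''done''} \<Longrightarrow> s' x = s x) \<Longrightarrow>
      ready s' \<Longrightarrow> painted s' = insert w (painted s) \<Longrightarrow> s' ''done'' = (s ''done'')(w := 1) \<Longrightarrow> Q s'"
  shows "wlp paint Q s"
proof (rule paint_correct[of N E s w])
  show "base N E s" "s ''sel'' 0 = w" "w < N" using r w by (simp_all add: ready_def)
  show "s ''k'' 0 \<le> N" using r k_le by (simp add: ready_def)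
  obtain a where a: "fits (painted s) (s ''col'') w a" using st unfolding step_def by blast
  then have "a = Suc (a - 1)" unfolding fits_def by auto
  then have "fits (painted s) (s ''col'') w (Suc (a - 1))" using a by metis
  then show "\<exists>a. admissible N E s w a" using admissible_iff_fits[OF r w(2,3)] by blast
next
  fix s' a
  assume fr: "\<And>x. x \<notin> {''a'', ''p'', ''x'', ''y'', ''bad'', ''ld'', ''best'', ''col'', ''done''} \<Longrightarrow> s' x = s x"
    and adm: "admissible N E s w a" and col: "s' ''col'' = (s ''col'')(w := Suc a)"
    and dn: "s' ''done'' = (s ''done'')(w := 1)"
  have wv: "w \<noteq> v" "w \<notin> nbrs" using unpainted[OF r w(2,3)] by auto
  have p: "painted s' = insert w (painted s)" using dn w wv by (auto simp: painted_def)
  have "good (insert w (painted s)) ((s ''col'')(w := Suc a))"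
    using st adm admissible_iff_fits[OF r w(2,3)] unfolding step_def by blast
  then have g: "good (painted s') (s' ''col'')" by (simp add: p col)
  have b': "base N E s'" by (rule base_frame[of N E s]) (use r in \<open>simp_all add: fr ready_def\<close>)
  have "inj_on (s' ''col'') nbrs"
    using r wv by (auto simp: ready_def col inj_on_def)
  then have "ready s'" using r b' g wv p by (auto simp: ready_def fr dn col)
  then show "Q s'" using post[of s'] fr p dn by blast
qed

lemma branches_correct:
  assumes r: "ready s" and gr: "growing (painted s)"
    and post: "\<And>s'. ready s' \<Longrightarrow> \<forall>u<N. s' ''done'' u = 0 \<longrightarrow> degree rest u \<le> 1 \<Longrightarrow> Q s'"
  shows "wlp branches Q s"
proof -
  let ?body = "Seq select_branch (Cond (Less (var ''sel'') (var ''n'')) paint Skip)"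
  let ?B = "\<lambda>t. {u. u < N \<and> t ''done'' u = 0 \<and> 1 < degree rest u}"
  let ?I = "\<lambda>m t. ready t \<and> growing (painted t) \<and> card (?B t) \<le> N - m"
  have n: "s ''n'' 0 = N" using r by (simp add: ready_def base_def)
  show ?thesis
    unfolding branches_def
  proof (rule wlp_For[where I = ?I])
    show "?I 0 s"
      using r gr card_mono[of "{..<N}" "?B s"] by (auto simp: subset_eq)
  next
    fix m s1 f
    assume I: "?I m s1"
    then have r1: "ready s1" by simp
    have "ready (s1(''r'' := f))" by (rule ready_frame(1)[OF r1]) auto
    moreover have "painted (s1(''r'' := f)) = painted s1" by (rule ready_frame(2)[OF r1]) auto
    ultimately show "?I m (s1(''r'' := f))" using I by simp
  next
    fix m s1
    assume m: "m < s ''n'' 0" and I: "?I m s1"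
    have r1: "ready s1" and gr1: "growing (painted s1)" and g1: "good (painted s1) (s1 ''col'')"
      using I by (auto simp: ready_def)
    define B where "B u \<longleftrightarrow> u < N \<and> s1 ''done'' u = 0 \<and> 1 < s1 ''deg'' u" for u
    define L where "L u \<longleftrightarrow> B u \<and> (\<exists>p<N. {u, p} \<in> E \<and> s1 ''done'' p = 1)" for u
    have Beq: "?B s1 = Collect B" using unpainted(3)[OF r1] by (auto simp: B_def)
    have Bin: "u \<in> {..<N} - {v} - painted s1 \<and> 2 \<le> degree rest u" if "B u" for u
      using that unpainted[OF r1] by (auto simp: B_def)
    have Lin: "L u \<longleftrightarrow> B u \<and> (\<exists>p\<in>painted s1. {u, p} \<in> rest)" for u
      using link_iff[OF r1] by (auto simp: L_def B_def)
    show "wlp ?body (?I (Suc m)) s1"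
      unfolding wlp_Seq
    proof (rule select_branch_correct[of N E s1 B L])
      show "base N E s1" using r1 by (simp add: ready_def)
    next
      fix s2
      assume fr: "\<And>x. x \<notin> {''u'', ''p'', ''sel''} \<Longrightarrow> s2 x = s1 x"
        and sel: "if \<exists>u. L u then L (s2 ''sel'' 0) else if \<exists>u. B u then B (s2 ''sel'' 0) else s2 ''sel'' 0 = N"
      have r2: "ready s2" by (rule ready_frame(1)[OF r1]) (auto simp: fr)
      have p2: "painted s2 = painted s1" by (rule ready_frame(2)[OF r1]) (auto simp: fr)
      have n2: "s2 ''n'' 0 = N" using r2 by (simp add: ready_def base_def)
      let ?w = "s2 ''sel'' 0"
      show "wlp (Cond (Less (var ''sel'') (var ''n'')) paint Skip) (?I (Suc m)) s2"
      proof (cases "\<exists>u. B u")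
        case False
        then have "?w = N" and B1: "?B s1 = {}" using sel Beq by (auto simp: L_def split: if_splits)
        moreover have B2: "?B s2 = {}" using B1 by (simp add: fr)
        have "card (?B s2) \<le> N - Suc m" unfolding B2 by simp
        ultimately show ?thesis using r2 gr1 p2 n2 by simp
      next
        case True
        then have Bw: "B ?w" and Lw: "L ?w \<or> \<not> (\<exists>u. L u)" using sel by (auto simp: L_def split: if_splits)
        have w: "?w < N" "s2 ''done'' ?w = 0" using Bw by (auto simp: B_def fr)
        have "\<not> (\<exists>u\<in>{..<N} - {v} - painted s1. 2 \<le> degree rest u \<and> (\<exists>p\<in>painted s1. {u, p} \<in> rest))"
          if "\<not> (\<exists>u. L u)"
        proof
          assume "\<exists>u\<in>{..<N} - {v} - painted s1. 2 \<le> degree rest u \<and> (\<exists>p\<in>painted s1. {u, p} \<in> rest)"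
          then obtain u where u: "u \<in> {..<N} - {v} - painted s1" "2 \<le> degree rest u"
            "\<exists>p\<in>painted s1. {u, p} \<in> rest" by blast
          then have "s1 ''done'' u = 0" "u < N" using unpainted_iff[OF r1, of u] by auto
          then have "B u" using u unpainted(3)[OF r1] by (auto simp: B_def)
          then show False using that Lin u by blast
        qed
        then have bs: "step (painted s1) (s1 ''col'') ?w \<and> growing (insert ?w (painted s1))"
          using branch_step[OF g1 gr1, of ?w] Bin[OF Bw] Lw Lin by blast
        have "wlp paint (?I (Suc m)) s2"
        proof (rule paint_ready[OF r2 refl w])
          show "step (painted s2) (s2 ''col'') ?w" using bs p2 by (simp add: fr)
        next
          fix s3
          assume r3: "ready s3" and p3: "painted s3 = insert ?w (painted s2)"
            and d3: "s3 ''done'' = (s2 ''done'')(?w := 1)"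
          have B3: "?B s3 = ?B s1 - {?w}" using d3 by (auto simp: fr)
          have "?w \<in> ?B s1" unfolding Beq using Bw by simp
          moreover have "finite (?B s1)" by simp
          ultimately have "card (?B s3) < card (?B s1)" unfolding B3 by (intro card_Diff1_less)
          then have "card (?B s3) \<le> N - Suc m" using I by linarith
          then show "?I (Suc m) s3" using r3 p3 p2 bs by simp
        qed
        then show ?thesis using w n2 by simp
      qed
    qed (simp_all add: B_def L_def)
  next
    fix s'
    assume "?I (s ''n'' 0) s'"
    then have I: "ready s'" "card (?B s') = 0" using n by auto
    then have B: "?B s' = {}" by (simp add: card_eq_0_iff)
    show "Q s'"
    proof (rule post[OF I(1)], intro allI impI, rule ccontr)
      fix u assume "u < N" "s' ''done'' u = 0" "\<not> degree rest u \<le> 1"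
      then have "u \<in> ?B s'" by simp
      then show False unfolding B by simp
    qed
  qed (simp_all add: select_branch_def paint_def choose_color_def conflict_def load_def)
qed

lemma leaves_correct:
  assumes r: "ready s" and leaf: "\<forall>u<N. s ''done'' u = 0 \<longrightarrow> degree rest u \<le> 1"
    and post: "\<And>s'. harmonious_coloring {..<N} E (s' ''col'') \<Longrightarrow> s' ''col'' ` {..<N} \<subseteq> {..k} \<Longrightarrow> Q s'"
  shows "wlp leaves Q s"
proof -
  let ?body = "Cond (Equal (Read ''done'' (var ''r'')) (Num 0)) (Seq (put ''sel'' (var ''r'')) paint) Skip"
  let ?I = "\<lambda>m t. ready t \<and> (\<forall>u<N. t ''done'' u = 0 \<longrightarrow> degree rest u \<le> 1) \<and> (\<forall>u<m. t ''done'' u = 1)"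
  have n: "s ''n'' 0 = N" using r by (simp add: ready_def base_def)
  show ?thesis
    unfolding leaves_def
  proof (rule wlp_For[where I = ?I])
    show "?I 0 s" using r leaf by simp
  next
    fix m s1 f
    assume I: "?I m s1"
    then have "ready s1" by simp
    then have "ready (s1(''r'' := f))" by (rule ready_frame(1)) auto
    then show "?I m (s1(''r'' := f))" using I by simp
  next
    fix m s1
    assume m: "m < s ''n'' 0" and I: "?I m s1" and i: "s1 ''r'' 0 = m"
    have mN: "m < N" using m n by simp
    show "wlp ?body (?I (Suc m)) s1"
    proof (cases "s1 ''done'' m = 0")
      case False
      have "s1 ''done'' m \<le> 1" using I by (simp add: ready_def)
      then show ?thesis using False I i by (auto simp: less_Suc_eq)
    next
      case True
      define s2 where "s2 = s1(''sel'' := (s1 ''sel'')(0 := m))"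
      have r2: "ready s2" by (rule ready_frame(1)[of s1]) (use I in \<open>auto simp: s2_def\<close>)
      have eq: "s2 ''done'' = s1 ''done''" "s2 ''col'' = s1 ''col''" by (simp_all add: s2_def)
      have "wlp paint (?I (Suc m)) s2"
      proof (rule paint_ready[OF r2 _ mN])
        show "s2 ''sel'' 0 = m" "s2 ''done'' m = 0" using True by (simp_all add: s2_def)
        show "step (painted s2) (s2 ''col'') m"
          using r2 unpainted(1)[OF r2 mN] True I mN by (intro leaf_step) (auto simp: ready_def eq)
      next
        fix s3
        assume "ready s3" "s3 ''done'' = (s2 ''done'')(m := 1)"
        then show "?I (Suc m) s3" using I by (auto simp: eq less_Suc_eq)
      qed
      then show ?thesis using True i by (simp add: s2_def)
    qed
  next
    fix s'
    assume "?I (s ''n'' 0) s'"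
    then have I: "ready s'" "\<forall>u<N. s' ''done'' u = 1" using n by auto
    then have "painted s' = {..<N} - {v}" by (auto simp: painted_def)
    then have "harmonious_coloring {..<N} E (s' ''col'') \<and> s' ''col'' ` {..<N} \<subseteq> {..k}"
      using I(1) by (intro harmonious_if_rest_good) (auto simp: ready_def)
    then show "Q s'" using post by blast
  qed (simp_all add: paint_def choose_color_def conflict_def load_def)
qed

text \<open>The color of a neighbor \<open>x\<close> is its rank among the neighbors of \<open>v\<close>, so these colors are
  different and at most the degree of \<open>v\<close>.\<close>

lemma star_ready:
  assumes b: "base N E s" and k': "s ''k'' 0 = k"
    and deg: "s ''deg'' = (\<lambda>x. d x - of_bool (x < N \<and> {v, x} \<in> E))" "\<forall>x<N. d x = degree E x"
    and dn: "s ''done'' = (\<lambda>x. of_bool (x = v \<or> x < N \<and> {v, x} \<in> E))"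
    and col: "s ''col'' = (\<lambda>x. if x < N \<and> {v, x} \<in> E then card {j. j < Suc x \<and> {v, j} \<in> E} else 0)"
  shows "ready s \<and> growing (painted s)"
proof -
  have nb: "x \<in> nbrs \<longleftrightarrow> x < N \<and> {v, x} \<in> E" for x using nbrs_subset by (auto simp: nbrs_def)
  have p: "painted s = nbrs" using nbrs_subset by (auto simp: painted_def dn nb)
  let ?c = "s ''col''"
  have less: "?c x < ?c y" if "x \<in> nbrs" "y \<in> nbrs" "x < y" for x y
  proof -
    have "y \<in> {j. j < Suc y \<and> {v, j} \<in> E} - {j. j < Suc x \<and> {v, j} \<in> E}"
      using that by (simp add: nb)
    moreover have "{j. j < Suc x \<and> {v, j} \<in> E} \<subseteq> {j. j < Suc y \<and> {v, j} \<in> E}"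
      using that(3) by (intro Collect_mono) simp
    ultimately have "{j. j < Suc x \<and> {v, j} \<in> E} \<subset> {j. j < Suc y \<and> {v, j} \<in> E}" by blast
    then have "card {j. j < Suc x \<and> {v, j} \<in> E} < card {j. j < Suc y \<and> {v, j} \<in> E}"
      by (intro psubset_card_mono) auto
    then show ?thesis using that by (simp add: col nb)
  qed
  have inj: "inj_on ?c nbrs"
  proof (rule inj_onI)
    fix x y assume "x \<in> nbrs" "y \<in> nbrs" "?c x = ?c y"
    then show "x = y" using less[of x y] less[of y x] by (cases x y rule: linorder_cases) simp_all
  qed
  have "?c ` nbrs \<subseteq> {1..k}"
  proof
    fix a assume "a \<in> ?c ` nbrs"
    then obtain x where x: "x \<in> nbrs" "a = card {j. j < Suc x \<and> {v, j} \<in> E}" by (auto simp: col nb)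
    have "x \<in> {j. j < Suc x \<and> {v, j} \<in> E}" using x nb by simp
    then have "0 < a" unfolding x(2) card_gt_0_iff by fastforce
    moreover have "a \<le> card nbrs"
      unfolding x(2) using x(1) nbrs_subset by (intro card_mono) (auto simp: nb intro: finite_subset)
    ultimately show "a \<in> {1..k}" using card_nbrs k by auto
  qed
  then have "good nbrs ?c \<and> growing nbrs" using good_nbrs[OF inj] by blast
  moreover have "{v, v} \<notin> E" by (rule no_loop)
  moreover have "\<forall>u<N. u \<noteq> v \<longrightarrow> s ''deg'' u = degree rest u"
    using deg degree_rest by (auto simp: nb)
  ultimately show ?thesis using b k' inj p by (auto simp: ready_def dn col)
qed

end

lemma color_forest_correct:
  assumes f: "forest {..<N} E" and big: "N + 2 \<le> 3 * max_degree {..<N} E"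
  shows "wlp color_forest (\<lambda>s. harmonious_coloring {..<N} E (s ''col'') \<and>
    s ''col'' ` {..<N} \<subseteq> {..palette_size {..<N} E}) (graph_input N E)"
    (is "wlp _ ?Q _")
proof -
  let ?s = "graph_input N E"
  have sg: "simple_graph {..<N} E" using f by (simp add: forest_def)
  have N: "0 < N"
  proof (rule ccontr)
    assume "\<not> 0 < N"
    then have "max_degree {..<N} E = 0" by (simp add: max_degree_def)
    then show False using big by simp
  qed
  have s: "?s ''n'' 0 = N" "?s ''row'' = (\<lambda>_. 0)" "?s ''deg'' = (\<lambda>_. 0)" "?s ''max'' = (\<lambda>_. 0)"
    "?s ''cnt'' = (\<lambda>_. 0)" "?s ''col'' = (\<lambda>_. 0)" "?s ''done'' = (\<lambda>_. 0)"
    "?s ''adj'' = (\<lambda>k. if k < N * N \<and> {k div N, k mod N} \<in> E then 1 else 0)"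
    by (simp_all add: graph_input_def)
  show ?thesis
    unfolding color_forest_def wlp_Seq
  proof (rule rows_correct[of ?s N])
    fix s1
    assume fr1: "\<And>x. x \<notin> {''i'', ''row''} \<Longrightarrow> s1 x = ?s x" and row: "\<forall>x<N. s1 ''row'' x = x * N"
    have "i * N + j < N * N" if "i < N" "j < N" for i j
    proof -
      have "i * N + j < Suc i * N" using that by simp
      also have "\<dots> \<le> N * N" using that by (intro mult_le_mono1) simp
      finally show ?thesis .
    qed
    then have b1: "base N E s1" using row N by (simp add: base_def fr1 s)
    show "wlp degrees (wlp center (wlp colors (wlp star (wlp branches (wlp leaves ?Q))))) s1"
    proof (rule degrees_correct[OF b1 _ sg])
      show "s1 ''deg'' = (\<lambda>_. 0)" by (simp add: fr1 s)
    next
      fix s2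
      assume fr2: "\<And>x. x \<notin> {''i'', ''j'', ''deg''} \<Longrightarrow> s2 x = s1 x" and deg: "\<forall>x<N. s2 ''deg'' x = degree E x"
      have b2: "base N E s2" by (rule base_frame[OF b1]) (simp_all add: fr2)
      show "wlp center (wlp colors (wlp star (wlp branches (wlp leaves ?Q)))) s2"
      proof (rule center_correct[of s2 N])
        show "s2 ''n'' 0 = N" "0 < N" using base_n[OF b2] N by simp_all
        show "s2 ''max'' 0 = 0" by (simp add: fr1 fr2 s)
      next
        fix s3
        assume fr3: "\<And>x. x \<notin> {''i'', ''max'', ''v''} \<Longrightarrow> s3 x = s2 x"
          and vN: "s3 ''v'' 0 < N" and dv: "s2 ''deg'' (s3 ''v'' 0) = s3 ''max'' 0"
          and le: "\<forall>x<N. s2 ''deg'' x \<le> s3 ''max'' 0"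
        define v where "v = s3 ''v'' 0"
        have maxd: "s3 ''max'' 0 = max_degree {..<N} E"
        proof -
          have "s3 ''max'' 0 = degree E (s3 ''v'' 0)" using dv vN deg by simp
          then have "s3 ''max'' 0 \<in> degree E ` {..<N}" using vN by blast
          moreover have "\<forall>x\<in>{..<N}. degree E x \<le> s3 ''max'' 0" using le deg by simp
          ultimately have "Max (insert 0 (degree E ` {..<N})) = s3 ''max'' 0"
            by (intro Max_eqI) auto
          then show ?thesis by (simp add: max_degree_def)
        qed
        have vx: "v < N" "degree E v = max_degree {..<N} E" using vN dv deg maxd by (auto simp: v_def)
        interpret running N E v "palette_size {..<N} E"
          unfolding running_def using f big vx by (intro big_star_max_degree) auto
        have b3: "base N E s3" by (rule base_frame[OF b2]) (simp_all add: fr3)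
        show "wlp colors (wlp star (wlp branches (wlp leaves ?Q))) s3"
        proof (rule colors_correct[OF b3])
          fix s4
          assume fr4: "\<And>x. x \<notin> {''i'', ''j'', ''k''} \<Longrightarrow> s4 x = s3 x"
            and k4: "s4 ''k'' 0 = s3 ''max'' 0 + of_bool (\<exists>i<N. \<exists>j<N. i \<noteq> j \<and> {i, j} \<notin> E \<and>
              s3 ''deg'' i = s3 ''max'' 0 \<and> s3 ''deg'' j = s3 ''max'' 0)"
          have d3: "s3 ''deg'' = s2 ''deg''" by (simp add: fr3)
          have "(\<exists>i<N. \<exists>j<N. i \<noteq> j \<and> {i, j} \<notin> E \<and>
              s3 ''deg'' i = s3 ''max'' 0 \<and> s3 ''deg'' j = s3 ''max'' 0) \<longleftrightarrow> twin {..<N} E"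
            unfolding twin_def d3 maxd using deg by (metis lessThan_iff)
          then have k: "s4 ''k'' 0 = palette_size {..<N} E" using k4 maxd by (simp add: palette_size_def)
          have b4: "base N E s4" by (rule base_frame[OF b3]) (simp_all add: fr4)
          show "wlp star (wlp branches (wlp leaves ?Q)) s4"
          proof (rule star_correct[OF b4 _ vx(1) no_loop])
            show "s4 ''v'' 0 = v" by (simp add: fr4 v_def)
            show "s4 ''cnt'' 0 = 0" "s4 ''col'' = (\<lambda>_. 0)" "s4 ''done'' = (\<lambda>_. 0)"
              by (simp_all add: fr1 fr2 fr3 fr4 s)
          next
            fix s5
            assume fr5: "\<And>x. x \<notin> {''i'', ''done'', ''cnt'', ''col'', ''deg''} \<Longrightarrow> s5 x = s4 x"
              and s5: "s5 ''done'' = (\<lambda>x. of_bool (x = v \<or> x < N \<and> {v, x} \<in> E))"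
                "s5 ''col'' = (\<lambda>x. if x < N \<and> {v, x} \<in> E then card {j. j < Suc x \<and> {v, j} \<in> E} else 0)"
                "s5 ''deg'' = (\<lambda>x. s4 ''deg'' x - of_bool (x < N \<and> {v, x} \<in> E))"
            have b5: "base N E s5" by (rule base_frame[OF b4]) (simp_all add: fr5)
            have "ready s5 \<and> growing (painted s5)"
              using b5 k deg s5 by (intro star_ready[of s5 "s4 ''deg''"]) (simp_all add: fr3 fr4 fr5)
            then show "wlp branches (wlp leaves ?Q) s5"
              by (intro branches_correct leaves_correct) auto
          qed
        qed
      qed
    qed
  qed (simp_all add: s)
qed

lemma big_nat: "(real n + 2) / 3 \<le> real m \<Longrightarrow> n + 2 \<le> 3 * m"
proof -
  assume "(real n + 2) / 3 \<le> real m"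
  then have "real (n + 2) \<le> real (3 * m)" by simp
  then show ?thesis by (simp only: of_nat_le_iff)
qed

theorem theorem1:
  shows "(\<forall>(V :: 'a set) E.
      forest V E \<longrightarrow>
      real (max_degree V E) \<ge> (real (card V) + 2) / 3 \<longrightarrow>
      harmonious_number V E =
        (if \<exists>u\<in>V. \<exists>v\<in>V. u \<noteq> v \<and> {u, v} \<notin> E \<and>
              degree E u = max_degree V E \<and> degree E v = max_degree V E
         then max_degree V E + 2
         else max_degree V E + 1))
    \<and>
    (\<exists>(prog :: com) (c :: nat) (d :: nat). \<forall>(n :: nat) (E :: nat set set).
      forest {..<n} E \<longrightarrow>
      real (max_degree {..<n} E) \<ge> (real n + 2) / 3 \<longrightarrow>
      (\<exists>t s. exec prog (graph_input n E) t s \<and> t \<le> c * n ^ d + c \<and>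
        harmonious_coloring {..<n} E (s ''col'') \<and>
        card (s ''col'' ` {..<n}) = harmonious_number {..<n} E))"
proof (intro conjI allI impI)
  fix V :: "'a set" and E
  assume "forest V E" "real (max_degree V E) \<ge> (real (card V) + 2) / 3"
  then have h: "harmonious_number V E = Suc (palette_size V E)"
    by (intro harmonious_number_forest big_nat)
  have "Suc (if P then Suc m else m) = (if P then m + 2 else m + 1)" for P and m :: nat by simp
  then show "harmonious_number V E =
        (if \<exists>u\<in>V. \<exists>v\<in>V. u \<noteq> v \<and> {u, v} \<notin> E \<and>
              degree E u = max_degree V E \<and> degree E v = max_degree V E
         then max_degree V E + 2
         else max_degree V E + 1)"
    unfolding h palette_size_def twin_def .
next
  obtain c d where time: "\<And>s. \<exists>t s'. exec color_forest s t s' \<and> t \<le> c * Suc (s ''n'' 0) ^ d"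
    using poly_time_color_forest unfolding poly_time_def by blast
  have grow: "Suc n ^ d \<le> 2 ^ d * n ^ d + 2 ^ d" for n
  proof (cases n)
    case (Suc m)
    then have "Suc n ^ d \<le> (2 * n) ^ d" by (intro power_mono) auto
    then show ?thesis by (simp add: power_mult_distrib)
  next
    case 0
    have "(1::nat) \<le> 2 ^ d" by simp
    then have "(1::nat) \<le> 2 ^ d * n ^ d + 2 ^ d" by (rule trans_le_add2)
    then show ?thesis using 0 by simp
  qed
  have "\<exists>t s. exec color_forest (graph_input n E) t s \<and> t \<le> c * 2 ^ d * n ^ d + c * 2 ^ d \<and>
        harmonious_coloring {..<n} E (s ''col'') \<and>
        card (s ''col'' ` {..<n}) = harmonious_number {..<n} E"
    if f: "forest {..<n} E" and "real (max_degree {..<n} E) \<ge> (real n + 2) / 3" for n E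
  proof -
    have big: "n + 2 \<le> 3 * max_degree {..<n} E" using that(2) by (rule big_nat)
    obtain t s where t: "exec color_forest (graph_input n E) t s"
      "t \<le> c * Suc (graph_input n E ''n'' 0) ^ d" using time by blast
    have "t \<le> c * Suc n ^ d" using t(2) by (simp add: graph_input_def)
    also have "\<dots> \<le> c * (2 ^ d * n ^ d + 2 ^ d)" using grow by (intro mult_le_mono2)
    finally have tb: "t \<le> c * 2 ^ d * n ^ d + c * 2 ^ d" by (simp add: algebra_simps)
    have s: "harmonious_coloring {..<n} E (s ''col'')" "s ''col'' ` {..<n} \<subseteq> {..palette_size {..<n} E}"
      using color_forest_correct[OF f big] t(1) by (auto simp: wlp_def)
    have "card (s ''col'' ` {..<n}) \<le> harmonious_number {..<n} E"
      using card_mono[OF _ s(2)] harmonious_number_forest[OF f] big by simp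
    moreover have "harmonious_number {..<n} E \<le> card (s ''col'' ` {..<n})"
      by (rule harmonious_number_le[OF s(1)])
    ultimately show ?thesis using t(1) tb s(1) by fastforce
  qed
  then show "\<exists>(prog :: com) (c :: nat) (d :: nat). \<forall>(n :: nat) (E :: nat set set).
      forest {..<n} E \<longrightarrow>
      real (max_degree {..<n} E) \<ge> (real n + 2) / 3 \<longrightarrow>
      (\<exists>t s. exec prog (graph_input n E) t s \<and> t \<le> c * n ^ d + c \<and>
        harmonious_coloring {..<n} E (s ''col'') \<and>
        card (s ''col'' ` {..<n}) = harmonious_number {..<n} E)"
    by blast
qed

end
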